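(* Let $1\le k<n$, let $\Omega\subset\mathbb{C}^n$ be a smooth bounded $(k-1)$-pseudoconvex domain containing the origin, and set $\gamma=2-2n/k$. For $r>0$ with $\overline{B_r(0)}\subset\Omega$ put $\Omega_r=\Omega\setminus\overline{B_r(0)}$. Suppose that $u^{\varepsilon,r}\in C^4(\Omega_r)\cap C^2(\overline{\Omega_r})$ is a negative $k$-admissible solution of $$\begin{cases}\sigma_k(D^2_{\mathbb C}u^{\varepsilon,r})=\varepsilon & \text{in }\Omega_r,\\ u^{\varepsilon,r}=\underline u & \text{on }\partial B_r(0),\\ u^{\varepsilon,r}=-1 & \text{on }\partial\Omega,\end{cases}$$ where $\varepsilon>0$ and $\underline u$ is the fixed subsolution described in the context, so that, for a constant $C_0>0$ depending only on $n,k,\Omega$ (and not on $\varepsilon$, $r$), $$C_0^{-1}|z|^\gamma\le -u^{\varepsilon,r}(z)\le C_0|z|^\gamma,\qquad |z|\,|Du^{\varepsilon,r}(z)|\le C_0(-u^{\varepsilon,r}(z))\quad\text{in }\Omega_r,$$ $$|z|^2|D^2u^{\varepsilon,r}(z)|\le C_0(-u^{\varepsilon,r}(z))\quad\text{on }\partial\Omega_r.$$ Then there is a constant $C$, depending only on $n,k,\Omega$, such that $$|D^2u^{\varepsilon,r}(z)|\le C|z|^{-2n/k}\quad\text{in }\overline{\Omega_r}.$$ In particular, $C$ is independent of the approximation parameters $\varepsilon$ and $r$.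
   Context: $Du$ and $D^2u$ denote the real gradient and real Hessian under $\mathbb{C}^n\simeq\mathbb{R}^{2n}$; $D^2_{\mathbb C}u=(u_{i\bar j})_{1\le i,j\le n}$ with $u_{i\bar j}=\partial^2u/\partial z_i\partial\bar z_j$ is the complex Hessian. For a Hermitian matrix $A$, $\sigma_k(A)$ is the $k$-th elementary symmetric polynomial of its eigenvalues. Let $\Gamma_j=\{\lambda\in\mathbb{R}^m:\sigma_1(\lambda)>0,\dots,\sigma_j(\lambda)>0\}$. A $C^2$ function $u$ is $k$-admissible if the eigenvalues of $D^2_{\mathbb C}u$ lie in $\Gamma_k\subset\mathbb{R}^n$ everywhere. A smooth bounded domain is $(k-1)$-pseudoconvex if at every boundary point the eigenvalues of the Levi form of $\partial\Omega$ (positive for strongly pseudoconvex domains) lie in $\Gamma_{k-1}\subset\mathbb{R}^{n-1}$ (no condition if $k=1$). The function $\underline u$ is a fixed subsolution, constructed in earlier work of Gao–Ma–Zhang, providing the boundary data on $\partial B_r(0)$; the only property of it that is relevant here is that negative $k$-admissible solutions $u^{\varepsilon,r}$ of the Dirichlet problem $\sigma_k(D^2_{\mathbb C}u^{\varepsilon,r})=\varepsilon$ in $\Omega_r=\Omega\setminus\overline{B_r(0)}$, $u^{\varepsilon,r}=\underline u$ on $\partial B_r(0)$, $u^{\varepsilon,r}=-1$ on $\partial\Omega$, satisfy, with $\gamma=2-2n/k$, the estimates $C_0^{-1}|z|^\gamma\le -u^{\varepsilon,r}(z)\le C_0|z|^\gamma$ and $|z|\,|Du^{\varepsilon,r}(z)|\le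 C_0(-u^{\varepsilon,r}(z))$ in $\Omega_r$, and $|z|^2|D^2u^{\varepsilon,r}(z)|\le C_0(-u^{\varepsilon,r}(z))$ on $\partial\Omega_r$, with a constant $C_0$ depending only on $n,k,\Omega$, which is the same for all approximation parameters $\varepsilon,r$ under consideration. *)

theory Defs
  imports "HOL-Analysis.Analysis"
begin

section \<open>Differentiability classes\<close>

definition dir_deriv :: "'a::real_normed_vector \<Rightarrow> ('a \<Rightarrow> 'b::real_normed_vector) \<Rightarrow> 'a \<Rightarrow> 'b" where
  "dir_deriv v f x = frechet_derivative f (at x) v"

primrec iter_deriv :: "'a::real_normed_vector list \<Rightarrow> ('a \<Rightarrow> real) \<Rightarrow> 'a \<Rightarrow> real" where
  "iter_deriv [] f = f"
| "iter_deriv (b # bs) f = dir_deriv b (iter_deriv bs f)"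

(* Only meant for open S: then differentiability on S is differentiability at each point of S. *)
definition C_on :: "nat \<Rightarrow> ('a::euclidean_space \<Rightarrow> real) \<Rightarrow> 'a set \<Rightarrow> bool" where
  "C_on m f S \<longleftrightarrow>
     (\<forall>bs. set bs \<subseteq> Basis \<and> length bs \<le> m \<longrightarrow>
        continuous_on S (iter_deriv bs f) \<and>
        (length bs < m \<longrightarrow> iter_deriv bs f differentiable_on S))"

definition smooth_on :: "('a::euclidean_space \<Rightarrow> real) \<Rightarrow> 'a set \<Rightarrow> bool" where
  "smooth_on f S \<longleftrightarrow> (\<forall>m. C_on m f S)"

(* Regularity up to the boundary of the open set S: f is continuous on the closure and its
   derivatives of order at most m in S extend continuously to the closure. *)
definition C_on_closure :: "nat \<Rightarrow> ('a::euclidean_space \<Rightarrow> real) \<Rightarrow> 'a set \<Rightarrow> bool" where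
  "C_on_closure m f S \<longleftrightarrow>
     C_on m f S \<and> continuous_on (closure S) f \<and>
     (\<forall>bs. set bs \<subseteq> Basis \<and> length bs \<le> m \<longrightarrow>
        (\<exists>g. continuous_on (closure S) g \<and> (\<forall>x\<in>S. g x = iter_deriv bs f x)))"

definition gradient :: "('a::euclidean_space \<Rightarrow> real) \<Rightarrow> 'a \<Rightarrow> 'a" where
  "gradient f x = (\<Sum>b\<in>Basis. dir_deriv b f x *\<^sub>R b)"

(* Entry (b, c) of the real Hessian at a point of closure S. For f of class C^2 up to the boundary,
   it is the ordinary second derivative at points of S, and its continuous extension at boundary
   points. *)
definition hessian_entry :: "('a::euclidean_space) set \<Rightarrow> ('a \<Rightarrow> real) \<Rightarrow> 'a \<Rightarrow> 'a \<Rightarrow> 'a \<Rightarrow> real" where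
  "hessian_entry S f b c x = Lim (at x within S) (iter_deriv [b, c] f)"

definition hessian_norm :: "('a::euclidean_space) set \<Rightarrow> ('a \<Rightarrow> real) \<Rightarrow> 'a \<Rightarrow> real" where
  "hessian_norm S f x = sqrt (\<Sum>b\<in>Basis. \<Sum>c\<in>Basis. (hessian_entry S f b c x)\<^sup>2)"

section \<open>Complex Hessian\<close>

definition wirtinger :: "'n \<Rightarrow> (complex ^ 'n::finite \<Rightarrow> complex) \<Rightarrow> complex ^ 'n \<Rightarrow> complex" where
  "wirtinger i f z = (dir_deriv (axis i 1) f z - \<i> * dir_deriv (axis i \<i>) f z) / 2"

definition wirtinger_bar :: "'n \<Rightarrow> (complex ^ 'n::finite \<Rightarrow> complex) \<Rightarrow> complex ^ 'n \<Rightarrow> complex" where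
  "wirtinger_bar j f z = (dir_deriv (axis j 1) f z + \<i> * dir_deriv (axis j \<i>) f z) / 2"

definition complex_hessian :: "(complex ^ 'n::finite \<Rightarrow> real) \<Rightarrow> complex ^ 'n \<Rightarrow> complex ^ 'n ^ 'n" where
  "complex_hessian u z =
     (\<chi> i j. wirtinger i (wirtinger_bar j (\<lambda>w. complex_of_real (u w))) z)"

section \<open>Elementary symmetric polynomials, Garding cones, k-Hessian operator\<close>

(* Eigenvalues counted with multiplicity are families indexed by a finite set I; all notions
   below are invariant under permutation of the family. *)
definition esym :: "nat \<Rightarrow> 'i set \<Rightarrow> ('i \<Rightarrow> real) \<Rightarrow> real" where
  "esym k I l = (\<Sum>S\<in>{S. S \<subseteq> I \<and> card S = k}. \<Prod>i\<in>S. l i)"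

definition Gamma_cone :: "nat \<Rightarrow> 'i set \<Rightarrow> ('i \<Rightarrow> real) set" where
  "Gamma_cone j I = {l. \<forall>i\<in>{1..j}. esym i I l > 0}"

(* The roots of the characteristic polynomial, with multiplicity and in an arbitrary order;
   such a real family exists for every Hermitian A. *)
definition eigenvalues :: "complex ^ 'n ^ 'n::finite \<Rightarrow> 'n \<Rightarrow> real" where
  "eigenvalues A =
     (SOME l. \<forall>t. det (mat t - A) = (\<Prod>i\<in>UNIV. t - complex_of_real (l i)))"

definition sigma :: "nat \<Rightarrow> complex ^ 'n ^ 'n::finite \<Rightarrow> real" where
  "sigma k A = esym k UNIV (eigenvalues A)"

definition k_admissible :: "nat \<Rightarrow> (complex ^ 'n::finite \<Rightarrow> real) \<Rightarrow> (complex ^ 'n) set \<Rightarrow> bool" where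
  "k_admissible k u S \<longleftrightarrow>
     C_on 2 u S \<and> (\<forall>z\<in>S. eigenvalues (complex_hessian u z) \<in> Gamma_cone k UNIV)"

section \<open>Smooth bounded domains and pseudoconvexity\<close>

definition local_defining_function ::
    "('a::euclidean_space) set \<Rightarrow> 'a \<Rightarrow> 'a set \<Rightarrow> ('a \<Rightarrow> real) \<Rightarrow> bool" where
  "local_defining_function \<Omega> p U \<rho> \<longleftrightarrow>
     open U \<and> p \<in> U \<and> smooth_on \<rho> U \<and> (\<forall>x\<in>U. gradient \<rho> x \<noteq> 0) \<and>
     \<Omega> \<inter> U = {x\<in>U. \<rho> x < 0}"

definition smooth_bounded_domain :: "('a::euclidean_space) set \<Rightarrow> bool" where
  "smooth_bounded_domain \<Omega> \<longleftrightarrow>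
     open \<Omega> \<and> connected \<Omega> \<and> \<Omega> \<noteq> {} \<and> bounded \<Omega> \<and>
     (\<forall>p\<in>frontier \<Omega>. \<exists>U \<rho>. local_defining_function \<Omega> p U \<rho>)"

definition cinner :: "complex ^ 'n::finite \<Rightarrow> complex ^ 'n \<Rightarrow> complex" where
  "cinner v w = (\<Sum>i\<in>UNIV. v $ i * cnj (w $ i))"

definition complex_tangent_space ::
    "(complex ^ 'n::finite \<Rightarrow> real) \<Rightarrow> complex ^ 'n \<Rightarrow> (complex ^ 'n) set" where
  "complex_tangent_space \<rho> p =
     {v. (\<Sum>i\<in>UNIV. wirtinger i (\<lambda>w. complex_of_real (\<rho> w)) p * v $ i) = 0}"

definition levi_form ::
    "(complex ^ 'n::finite \<Rightarrow> real) \<Rightarrow> complex ^ 'n \<Rightarrow> complex ^ 'n \<Rightarrow> complex ^ 'n \<Rightarrow> complex" where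
  "levi_form \<rho> p v w =
     (\<Sum>i\<in>UNIV. \<Sum>j\<in>UNIV. complex_hessian \<rho> p $ i $ j * v $ i * cnj (w $ j))"

(* l lists, with multiplicity, the n - 1 eigenvalues of the Levi form on the complex tangent space
   (with respect to the standard Hermitian inner product): there is a unitary basis e of that
   space consisting of eigenvectors. The list is unique up to order. Replacing the defining
   function by another one multiplies all eigenvalues by the same positive number, so membership in
   a cone Gamma_j does not depend on the defining function. *)
definition levi_eigenvalues ::
    "(complex ^ 'n::finite \<Rightarrow> real) \<Rightarrow> complex ^ 'n \<Rightarrow> (nat \<Rightarrow> real) \<Rightarrow> bool" where
  "levi_eigenvalues \<rho> p l \<longleftrightarrow>
     (\<exists>e. (\<forall>a < CARD('n) - 1. \<forall>b < CARD('n) - 1. cinner (e a) (e b) = (if a = b then 1 else 0)) \<and>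
          vec.span (e ` {..<CARD('n) - 1}) = complex_tangent_space \<rho> p \<and>
          (\<forall>a < CARD('n) - 1. \<forall>w \<in> complex_tangent_space \<rho> p.
              levi_form \<rho> p (e a) w = complex_of_real (l a) * cinner (e a) w))"

(* j-pseudoconvexity; for j = 0 the condition is void. *)
definition pseudoconvex :: "nat \<Rightarrow> (complex ^ 'n::finite) set \<Rightarrow> bool" where
  "pseudoconvex j \<Omega> \<longleftrightarrow>
     (\<forall>p\<in>frontier \<Omega>. \<forall>U \<rho> l.
        local_defining_function \<Omega> p U \<rho> \<and> levi_eigenvalues \<rho> p l \<longrightarrow>
        l \<in> Gamma_cone j {..<CARD('n) - 1})"

section \<open>The approximating Dirichlet problems\<close>

abbreviation punctured_domain :: "(complex ^ 'n::finite) set \<Rightarrow> real \<Rightarrow> (complex ^ 'n) set" where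
  "punctured_domain \<Omega> r \<equiv> \<Omega> - cball 0 r"

definition dirichlet_solution ::
    "nat \<Rightarrow> (complex ^ 'n::finite) set \<Rightarrow> (complex ^ 'n \<Rightarrow> real) \<Rightarrow> real \<Rightarrow> real \<Rightarrow>
     (complex ^ 'n \<Rightarrow> real) \<Rightarrow> bool" where
  "dirichlet_solution k \<Omega> usub \<epsilon> r u \<longleftrightarrow>
     C_on 4 u (punctured_domain \<Omega> r) \<and>
     C_on_closure 2 u (punctured_domain \<Omega> r) \<and>
     k_admissible k u (punctured_domain \<Omega> r) \<and>
     (\<forall>z\<in>punctured_domain \<Omega> r. u z < 0) \<and>
     (\<forall>z\<in>punctured_domain \<Omega> r. sigma k (complex_hessian u z) = \<epsilon>) \<and>
     (\<forall>z\<in>sphere 0 r. u z = usub z) \<and>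
     (\<forall>z\<in>frontier \<Omega>. u z = -1)"

definition hessian_exponent :: "nat \<Rightarrow> nat \<Rightarrow> real" where
  "hessian_exponent n k = 2 - 2 * real n / real k"

definition a_priori_estimates ::
    "nat \<Rightarrow> (complex ^ 'n::finite) set \<Rightarrow> real \<Rightarrow> real \<Rightarrow> (complex ^ 'n \<Rightarrow> real) \<Rightarrow> bool" where
  "a_priori_estimates k \<Omega> C0 r u \<longleftrightarrow>
     (\<forall>z\<in>punctured_domain \<Omega> r.
        inverse C0 * norm z powr hessian_exponent CARD('n) k \<le> - u z \<and>
        - u z \<le> C0 * norm z powr hessian_exponent CARD('n) k \<and>
        norm z * norm (gradient u z) \<le> C0 * (- u z)) \<and>
     (\<forall>z\<in>frontier (punctured_domain \<Omega> r).
        (norm z)\<^sup>2 * hessian_norm (punctured_domain \<Omega> r) u z \<le> C0 * (- u z))"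

end

theory Submission
  imports Defs "HOL-Computational_Algebra.Polynomial"
begin

text \<open>The equation is invariant under the unitary group and, after rescaling, under dilations: for
\<open>B = a I + S\<close> with \<open>S\<close> skew-Hermitian, the functions \<open>u\<^sub>t(z) = exp (- 2 a t) u (exp (t B) z)\<close>
solve the same equation as \<open>u\<close>. Let \<open>L\<close> be the linearization of \<open>\<sigma>\<^sub>k\<close> at the complex Hessian of
\<open>u\<close> at a point \<open>z\<close>. By Garding's inequality \<open>L\<close>, restricted to the Hermitian matrices with
eigenvalues in \<open>\<Gamma>\<^sub>k\<close> and with \<open>\<sigma>\<^sub>k = \<epsilon>\<close>, is smallest at the complex Hessian of \<open>u\<close> itself. So
\<open>L\<close> of the complex Hessian of \<open>u\<^sub>t\<close> at \<open>z\<close> is minimal at \<open>t = 0\<close>, and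
\<open>w = d\<^sup>2 u\<^sub>t / d t\<^sup>2\<close> at \<open>t = 0\<close> satisfies \<open>L w \<ge> 0\<close>, whereas \<open>L u = k \<epsilon> > 0\<close>. Hence
\<open>w + C u\<close> with \<open>C > 0\<close> has no interior maximum.

Now \<open>w(z)\<close> is \<open>D\<^sup>2 u (B z, B z)\<close> plus terms in \<open>u\<close> and \<open>D u\<close> which, as \<open>|B z| \<le> c |z|\<close>, are of
size \<open>- u\<close> by the gradient estimate. The boundary estimate says that \<open>D\<^sup>2 u (B z, B z)\<close> is of that
size on the boundary too. So for \<open>C\<close> large, \<open>w \<le> C (- u)\<close> holds on the boundary, hence inside
(\<open>maximum_principle\<close>). The point is that \<open>- u\<close> is a supersolution and has the growth that is
wanted for \<open>w\<close>. Since the unitary group and the dilations act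
transitively, \<open>B z\<close> can be any vector of length at most \<open>|z|\<close> (\<open>conformal_flow\<close>), which bounds
\<open>|z|\<^sup>2 D\<^sup>2 u (e, e)\<close> above by a multiple of \<open>- u\<close> for every unit vector \<open>e\<close>. The Laplacian is
positive because \<open>\<sigma>\<^sub>1 > 0\<close>, so these upper bounds imply lower ones, and \<open>- u \<le> C\<^sub>0 |z|\<^sup>\<gamma>\<close>
gives the exponent \<open>\<gamma> - 2 = - 2 n / k\<close>.

The function \<open>w\<close> already contains two derivatives of \<open>u\<close>. Instead of differentiating it twice more,
the maximum principle is applied to the difference quotients \<open>(u\<^sub>\<tau> + u\<^sub>-\<^sub>\<tau> - 2 u) / \<tau>\<^sup>2\<close>, to which
Garding's inequality applies directly. They converge to \<open>w\<close> uniformly on compact sets, as the second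
derivative of \<open>u\<^sub>t(z)\<close> in \<open>t\<close> is \<open>exp (- 2 a t) w (exp (t B) z)\<close>.

Garding's inequality for vectors follows from the concavity of \<open>e\<^sub>k\<^sub>+\<^sub>1 / e\<^sub>k\<close> on \<open>\<Gamma>\<^sub>k\<^sub>+\<^sub>1\<close>
(\<open>marcus_lopes\<close>), an induction that deletes variables and so needs \<open>Gamma_cone_remove\<close>; the latter
comes from the fact that \<open>e\<^sub>k\<close> has no zero with all variables in the upper half plane
(\<open>elsym_stable\<close>). The passage to Hermitian matrices (\<open>garding_matrix\<close>) uses the spectral theorem and
a rearrangement inequality for doubly stochastic matrices.\<close>

section \<open>Elementary symmetric polynomials and Garding's inequality for vectors\<close>

text \<open>\<open>esym\<close> over an arbitrary commutative ring: the proof of Newton's inequality needs complex variables.\<close>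
definition elsym :: "nat \<Rightarrow> 'i set \<Rightarrow> ('i \<Rightarrow> 'a::comm_ring_1) \<Rightarrow> 'a" where
  "elsym k I w = (\<Sum>S\<in>{S. S \<subseteq> I \<and> card S = k}. \<Prod>i\<in>S. w i)"

lemma esym_eq_elsym: "esym = elsym"
  by (simp add: fun_eq_iff esym_def elsym_def)

lemma elsym_0: "finite I \<Longrightarrow> elsym 0 I w = 1"
proof -
  assume "finite I"
  then have "{S. S \<subseteq> I \<and> card S = 0} = {{}}"
    by (auto dest: finite_subset)
  then show ?thesis by (simp add: elsym_def)
qed

lemma elsym_eq_0:
  assumes "finite I" "card I < k" shows "elsym k I w = 0"
proof -
  have "{S. S \<subseteq> I \<and> card S = k} = {}"
    using assms card_mono leD by blast
  then show ?thesis by (simp only: elsym_def sum.empty)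
qed

lemma elsym_insert:
  assumes "finite I" "a \<notin> I"
  shows "elsym (Suc k) (insert a I) w = w a * elsym k I w + elsym (Suc k) I w"
proof -
  let ?X = "{S. S \<subseteq> I \<and> card S = k}" and ?Y = "{S. S \<subseteq> I \<and> card S = Suc k}"
  have fin: "finite S" if "S \<subseteq> I" for S using that assms finite_subset by blast
  have split: "{S. S \<subseteq> insert a I \<and> card S = Suc k} = insert a ` ?X \<union> ?Y"
  proof (intro set_eqI iffI)
    fix S assume S: "S \<in> {S. S \<subseteq> insert a I \<and> card S = Suc k}"
    show "S \<in> insert a ` ?X \<union> ?Y"
    proof (cases "a \<in> S")
      case True
      then have "S = insert a (S - {a})" "S - {a} \<in> ?X"
        using S by auto
      then show ?thesis by blast
    qed (use S in auto)
  next
    fix S assume "S \<in> insert a ` ?X \<union> ?Y"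
    then show "S \<in> {S. S \<subseteq> insert a I \<and> card S = Suc k}"
    proof
      assume "S \<in> insert a ` ?X"
      then obtain R where R: "R \<subseteq> I" "card R = k" "S = insert a R" by auto
      then have "a \<notin> R" using assms by auto
      then show ?thesis using R fin by (auto simp: card_insert_disjoint)
    qed auto
  qed
  have inj: "inj_on (insert a) ?X"
    using assms(2) by (intro inj_onI) (metis (mono_tags, lifting) insert_ident mem_Collect_eq subsetD)
  have "elsym (Suc k) (insert a I) w
      = (\<Sum>S\<in>insert a ` ?X. \<Prod>i\<in>S. w i) + (\<Sum>S\<in>?Y. \<Prod>i\<in>S. w i)"
    unfolding elsym_def split using assms by (intro sum.union_disjoint) auto
  also have "(\<Sum>S\<in>insert a ` ?X. \<Prod>i\<in>S. w i) = (\<Sum>S\<in>?X. \<Prod>i\<in>insert a S. w i)"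
    using inj by (simp add: sum.reindex)
  also have "\<dots> = (\<Sum>S\<in>?X. w a * (\<Prod>i\<in>S. w i))"
    using assms fin by (intro sum.cong refl prod.insert) auto
  finally show ?thesis by (simp add: elsym_def sum_distrib_left)
qed

lemma elsym_remove:
  assumes "finite I" "i \<in> I"
  shows "elsym (Suc k) I w = w i * elsym k (I - {i}) w + elsym (Suc k) (I - {i}) w"
  using elsym_insert[of "I - {i}" i k w] assms by (simp add: insert_absorb)

lemma elsym_1: "finite I \<Longrightarrow> elsym (Suc 0) I w = (\<Sum>i\<in>I. w i)"
proof (induction I rule: finite_induct)
  case empty then show ?case by (simp add: elsym_eq_0)
next
  case (insert x F) then show ?case by (simp add: elsym_insert elsym_0)
qed

lemma elsym_cong: "(\<And>i. i \<in> I \<Longrightarrow> w i = v i) \<Longrightarrow> elsym k I w = elsym k I v"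
  unfolding elsym_def by (intro sum.cong prod.cong refl) auto

text \<open>Euler's identity for homogeneous functions: \<open>elsym k (I - {i}) w\<close> is the derivative of
\<open>elsym (Suc k) I w\<close> with respect to \<open>w i\<close>.\<close>
lemma elsym_euler:
  assumes "finite I"
  shows "(\<Sum>i\<in>I. w i * elsym k (I - {i}) w) = of_nat (Suc k) * elsym (Suc k) I w"
  using assms
proof (induction I arbitrary: k rule: finite_induct)
  case empty then show ?case by (simp add: elsym_eq_0)
next
  case (insert a I)
  have del: "insert a I - {i} = insert a (I - {i})" if "i \<in> I" for i
    using that insert.hyps by auto
  have *: "(\<Sum>i\<in>insert a I. w i * elsym k (insert a I - {i}) w)
     = w a * elsym k I w + (\<Sum>i\<in>I. w i * elsym k (insert a (I - {i})) w)"
    using insert.hyps by (simp add: del insert_absorb)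
  show ?case
  proof (cases k)
    case 0
    then show ?thesis using * insert.hyps by (simp add: elsym_0 elsym_1)
  next
    case (Suc l)
    have "(\<Sum>i\<in>I. w i * elsym k (insert a (I - {i})) w)
        = (\<Sum>i\<in>I. w a * (w i * elsym l (I - {i}) w) + w i * elsym k (I - {i}) w)"
      using insert.hyps by (intro sum.cong refl) (simp add: Suc elsym_insert algebra_simps)
    also have "\<dots> = w a * (of_nat k * elsym k I w) + of_nat (Suc k) * elsym (Suc k) I w"
      by (simp add: sum.distrib sum_distrib_left[symmetric] insert.IH Suc del: of_nat_Suc)
    finally show ?thesis using * insert.hyps by (simp add: elsym_insert algebra_simps)
  qed
qed

lemma elsym_reindex:
  assumes "bij_betw p I J"
  shows "elsym k I (\<lambda>i. w (p i)) = elsym k J w"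
proof -
  have inj: "inj_on p I" and img: "p ` I = J" using assms by (auto simp: bij_betw_def)
  have b: "bij_betw ((`) p) {S. S \<subseteq> I \<and> card S = k} {S. S \<subseteq> J \<and> card S = k}"
    unfolding bij_betw_def
  proof
    show "inj_on ((`) p) {S. S \<subseteq> I \<and> card S = k}"
      using inj by (intro inj_onI) (metis (mono_tags, lifting) inj_on_image_eq_iff mem_Collect_eq)
    show "(`) p ` {S. S \<subseteq> I \<and> card S = k} = {S. S \<subseteq> J \<and> card S = k}"
    proof (intro set_eqI iffI)
      fix S assume "S \<in> (`) p ` {S. S \<subseteq> I \<and> card S = k}"
      then obtain R where "R \<subseteq> I" "card R = k" "S = p ` R" by auto
      then show "S \<in> {S. S \<subseteq> J \<and> card S = k}"
        using inj img by (auto simp: card_image inj_on_subset)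
    next
      fix S assume S: "S \<in> {S. S \<subseteq> J \<and> card S = k}"
      then obtain R where R: "R \<subseteq> I" "S = p ` R" using img by (metis mem_Collect_eq subset_imageE)
      then have "card R = k" using S inj by (auto simp: card_image inj_on_subset)
      then show "S \<in> (`) p ` {S. S \<subseteq> I \<and> card S = k}" using R by blast
    qed
  qed
  have "elsym k J w = (\<Sum>S\<in>{S. S \<subseteq> I \<and> card S = k}. \<Prod>i\<in>p ` S. w i)"
    unfolding elsym_def by (rule sum.reindex_bij_betw[OF b, symmetric])
  also have "\<dots> = elsym k I (\<lambda>i. w (p i))"
    unfolding elsym_def using inj by (intro sum.cong refl) (auto simp: prod.reindex inj_on_subset)
  finally show ?thesis ..
qed

lemma elsym_of_real: "elsym k I (\<lambda>i. complex_of_real (l i)) = complex_of_real (elsym k I l)"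
  by (simp add: elsym_def)

text \<open>The map \<open>w \<mapsto> - 1 / w\<close> preserves the upper half plane, and \<open>w q / (w + q)\<close> is
\<open>1 / (1 / w + 1 / q)\<close>.\<close>
lemma parallel_sum_upper_half_plane:
  assumes "Im w > 0" "Im q > 0"
  shows "Im (w * q / (w + q)) > 0"
proof -
  have "Im (w * q / (w + q)) = (Im w * (cmod q)\<^sup>2 + Im q * (cmod w)\<^sup>2) / (cmod (w + q))\<^sup>2"
    unfolding Im_divide cmod_power2 by (simp add: power2_eq_square algebra_simps)
  moreover have "w + q \<noteq> 0" "q \<noteq> 0" using assms by (auto simp: complex_eq_iff)
  ultimately show ?thesis using assms by (auto intro!: divide_pos_pos add_pos_nonneg)
qed

text \<open>By Euler's identity the quotient \<open>e\<^sub>k\<^sub>+\<^sub>1(I) / e\<^sub>k(I)\<close> is the average over \<open>i\<close>, up to a positive factor, of the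
parallel sums of \<open>w i\<close> and \<open>e\<^sub>k(I - {i}) / e\<^sub>k\<^sub>-\<^sub>1(I - {i})\<close>. So it lies in the upper half plane by
induction, and \<open>e\<^sub>k(I)\<close> cannot vanish for \<open>k \<le> card I\<close>.\<close>
lemma elsym_stable:
  assumes "finite I" "k < card I" "\<And>i. i \<in> I \<Longrightarrow> Im (w i) > 0"
  shows "elsym k I w \<noteq> 0 \<and> Im (elsym (Suc k) I w / elsym k I w) > 0"
  using assms
proof (induction k arbitrary: I)
  case 0
  then have "I \<noteq> {}" by auto
  then have "0 < (\<Sum>i\<in>I. Im (w i))" using 0 by (intro sum_pos) auto
  then show ?case using 0 by (simp add: elsym_0 elsym_1)
next
  case (Suc k)
  have E: "elsym (Suc k) I w \<noteq> 0"
    using Suc.IH[OF Suc.prems(1)] Suc.prems by force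
  have pos: "Im (w i * elsym (Suc k) (I - {i}) w / elsym (Suc k) I w) > 0" if i: "i \<in> I" for i
  proof -
    let ?q = "elsym (Suc k) (I - {i}) w / elsym k (I - {i}) w"
    have IH: "elsym k (I - {i}) w \<noteq> 0" "Im ?q > 0"
      using Suc.IH[of "I - {i}"] Suc.prems i by auto
    have "elsym (Suc k) I w = elsym k (I - {i}) w * (w i + ?q)"
      using IH(1) by (simp add: elsym_remove[OF Suc.prems(1) i] field_simps)
    then have "w i * elsym (Suc k) (I - {i}) w / elsym (Suc k) I w = w i * ?q / (w i + ?q)"
      using IH(1) by simp
    then show ?thesis
      using parallel_sum_upper_half_plane[OF Suc.prems(3)[OF i] IH(2)] by (simp only:)
  qed
  have "elsym (Suc (Suc k)) I w
      = (\<Sum>i\<in>I. w i * elsym (Suc k) (I - {i}) w) / of_nat (Suc (Suc k))"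
    using elsym_euler[OF Suc.prems(1), of w "Suc k"] by (simp del: of_nat_Suc)
  then have "elsym (Suc (Suc k)) I w / elsym (Suc k) I w
    = (\<Sum>i\<in>I. w i * elsym (Suc k) (I - {i}) w / elsym (Suc k) I w) / of_nat (Suc (Suc k))"
    by (simp only: sum_divide_distrib[symmetric] divide_divide_eq_left mult.commute)
  then have "Im (elsym (Suc (Suc k)) I w / elsym (Suc k) I w)
    = (\<Sum>i\<in>I. Im (w i * elsym (Suc k) (I - {i}) w / elsym (Suc k) I w)) / real (Suc (Suc k))"
    by (simp only: Im_divide_of_nat Im_sum)
  moreover have "I \<noteq> {}" using Suc.prems by auto
  ultimately show ?case using E pos Suc.prems(1) by (auto intro!: divide_pos_pos sum_pos)
qed

text \<open>Put \<open>\<i>\<close> for the variable \<open>i\<close> and let the other variables tend to the real numbers \<open>l\<close> from the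
upper half plane. By stability the imaginary part of \<open>e\<^sub>k\<^sub>+\<^sub>2(I)\<close> times the conjugate of
\<open>e\<^sub>k\<^sub>+\<^sub>1(I)\<close> is nonnegative in the limit, where it equals the difference of the two sides.\<close>
lemma newton_inequality:
  fixes l :: "'i \<Rightarrow> real"
  assumes fin: "finite I" and i: "i \<in> I"
  shows "elsym k (I - {i}) l * elsym (Suc (Suc k)) (I - {i}) l \<le> (elsym (Suc k) (I - {i}) l)\<^sup>2"
proof (cases "Suc k < card I")
  case False
  then have "card (I - {i}) < Suc (Suc k)" using fin i by simp
  then show ?thesis using fin by (simp add: elsym_eq_0)
next
  case True
  let ?J = "I - {i}"
  define w where "w e j = (if j = i then \<i> else complex_of_real (l j) + \<i> * of_real e)" for e :: real and j
  define f where "f e = Im (elsym (Suc (Suc k)) I (w e) * cnj (elsym (Suc k) I (w e)))" for e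
  have cont: "continuous_on UNIV (\<lambda>e. w e j)" for j
    by (cases "j = i") (auto simp: w_def intro!: continuous_intros)
  have "continuous_on UNIV f"
    unfolding f_def elsym_def by (intro continuous_intros cont)
  then have "isCont f 0" by (simp add: continuous_on_eq_continuous_at)
  then have lim: "(f \<longlongrightarrow> f 0) (at_right 0)"
    using filterlim_at_split isCont_def by blast
  have "f e > 0" if "e > 0" for e
  proof -
    have st: "elsym (Suc k) I (w e) \<noteq> 0" "Im (elsym (Suc (Suc k)) I (w e) / elsym (Suc k) I (w e)) > 0"
      using elsym_stable[of I "Suc k" "w e"] True fin that by (auto simp: w_def)
    have "elsym (Suc (Suc k)) I (w e) * cnj (elsym (Suc k) I (w e))
       = (elsym (Suc (Suc k)) I (w e) / elsym (Suc k) I (w e)) * of_real ((cmod (elsym (Suc k) I (w e)))\<^sup>2)"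
      using st(1) by (simp add: complex_norm_square del: of_real_power)
    moreover have "Im (c * of_real x) = Im c * x" for c x by simp
    ultimately have "f e = Im (elsym (Suc (Suc k)) I (w e) / elsym (Suc k) I (w e)) * (cmod (elsym (Suc k) I (w e)))\<^sup>2"
      unfolding f_def by (simp only:)
    then show ?thesis using st by simp
  qed
  then have "0 \<le> f 0"
    by (intro tendsto_lowerbound[OF lim]) (auto intro!: less_imp_le eventually_mono[OF eventually_at_right_less])
  also have "f 0 = (elsym (Suc k) ?J l)\<^sup>2 - elsym k ?J l * elsym (Suc (Suc k)) ?J l"
  proof -
    have J: "elsym m ?J (w 0) = complex_of_real (elsym m ?J l)" for m
      unfolding elsym_of_real[symmetric] by (rule elsym_cong) (simp add: w_def)
    have "w 0 i = \<i>" by (simp add: w_def)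
    then show ?thesis
      unfolding f_def elsym_remove[OF fin i] J by (simp add: power2_eq_square)
  qed
  finally show ?thesis by simp
qed

lemma Gamma_cone_elsym: "l \<in> Gamma_cone j I \<longleftrightarrow> (\<forall>i. 1 \<le> i \<and> i \<le> j \<longrightarrow> elsym i I l > 0)"
  by (auto simp: Gamma_cone_def esym_eq_elsym)

lemma Gamma_cone_mono: "l \<in> Gamma_cone j I \<Longrightarrow> i \<le> j \<Longrightarrow> l \<in> Gamma_cone i I"
  by (auto simp: Gamma_cone_elsym)

lemma Gamma_cone_pos: "finite I \<Longrightarrow> l \<in> Gamma_cone j I \<Longrightarrow> i \<le> j \<Longrightarrow> elsym i I l > 0"
  by (cases i) (auto simp: Gamma_cone_elsym elsym_0)

text \<open>If \<open>e\<^sub>j(I - {i}) > 0\<close> but \<open>e\<^sub>j\<^sub>+\<^sub>1(I - {i}) \<le> 0\<close>, then the positivity of \<open>e\<^sub>j\<^sub>+\<^sub>1(I)\<close> and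
\<open>e\<^sub>j\<^sub>+\<^sub>2(I)\<close> bounds \<open>l i\<close> below and forces \<open>e\<^sub>j\<^sub>+\<^sub>2(I - {i})\<close> to be so large that Newton's
inequality fails.\<close>
lemma Gamma_cone_remove:
  assumes fin: "finite I" and i: "i \<in> I" and l: "l \<in> Gamma_cone (Suc k) I"
  shows "l \<in> Gamma_cone k (I - {i})"
proof -
  let ?e = "\<lambda>j. elsym j (I - {i}) l"
  have "j \<le> k \<Longrightarrow> ?e j > 0" for j
  proof (induction j)
    case 0 then show ?case using fin by (simp add: elsym_0)
  next
    case (Suc j)
    have a: "?e j > 0" using Suc by simp
    have 1: "l i * ?e j + ?e (Suc j) > 0"
      using Gamma_cone_pos[OF fin l, of "Suc j"] Suc.prems elsym_remove[OF fin i, of j l] by simp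
    have 2: "l i * ?e (Suc j) + ?e (Suc (Suc j)) > 0"
      using Gamma_cone_pos[OF fin l, of "Suc (Suc j)"] Suc.prems elsym_remove[OF fin i, of "Suc j" l] by simp
    show ?case
    proof (rule ccontr)
      assume "\<not> ?e (Suc j) > 0"
      then have neg: "- ?e (Suc j) \<ge> 0" by simp
      have "(?e (Suc j))\<^sup>2 = (- ?e (Suc j)) * (- ?e (Suc j))" by (simp add: power2_eq_square)
      also have "\<dots> \<le> (l i * ?e j) * (- ?e (Suc j))"
        using 1 neg by (intro mult_right_mono) auto
      also have "\<dots> = ?e j * (- (l i * ?e (Suc j)))" by simp
      also have "\<dots> < ?e j * ?e (Suc (Suc j))" using a 2 by (intro mult_strict_left_mono) auto
      finally show False using newton_inequality[OF fin i, of j l] by simp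
    qed
  qed
  then show ?thesis by (auto simp: Gamma_cone_elsym)
qed

text \<open>The derivative of \<open>elsym k I\<close> at \<open>l\<close> in the direction \<open>m\<close>.\<close>
primrec elsym_deriv :: "nat \<Rightarrow> 'i set \<Rightarrow> ('i \<Rightarrow> real) \<Rightarrow> ('i \<Rightarrow> real) \<Rightarrow> real" where
  "elsym_deriv 0 I l m = 0"
| "elsym_deriv (Suc k) I l m = (\<Sum>i\<in>I. m i * elsym k (I - {i}) l)"

text \<open>The derivative of the recursion \<open>elsym_remove\<close>.\<close>
lemma elsym_deriv_remove:
  assumes fin: "finite I" and i: "i \<in> I"
  shows "elsym_deriv (Suc k) I l m
    = m i * elsym k (I - {i}) l + l i * elsym_deriv k (I - {i}) l m + elsym_deriv (Suc k) (I - {i}) l m"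
proof (cases k)
  case 0
  then show ?thesis using assms by (simp add: elsym_0 sum.remove)
next
  case (Suc j)
  have "elsym_deriv (Suc k) I l m = m i * elsym k (I - {i}) l + (\<Sum>s\<in>I - {i}. m s * elsym k (I - {s}) l)"
    using assms by (simp add: sum.remove)
  also have "(\<Sum>s\<in>I - {i}. m s * elsym k (I - {s}) l)
     = (\<Sum>s\<in>I - {i}. l i * (m s * elsym j (I - {i} - {s}) l) + m s * elsym k (I - {i} - {s}) l)"
  proof (intro sum.cong refl)
    fix s assume "s \<in> I - {i}"
    then have "i \<in> I - {s}" "I - {s} - {i} = I - {i} - {s}" using i by auto
    then show "m s * elsym k (I - {s}) l = l i * (m s * elsym j (I - {i} - {s}) l) + m s * elsym k (I - {i} - {s}) l"
      using elsym_remove[of "I - {s}" i j l] fin Suc by (simp add: algebra_simps)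
  qed
  finally show ?thesis by (simp add: Suc sum.distrib sum_distrib_left)
qed

text \<open>The derivative of Euler's identity \<open>elsym_euler\<close>.\<close>
lemma elsym_deriv_euler:
  assumes fin: "finite I"
  shows "(\<Sum>i\<in>I. m i * elsym k (I - {i}) l + l i * elsym_deriv k (I - {i}) l m)
    = real (Suc k) * elsym_deriv (Suc k) I l m"
proof (cases k)
  case 0 then show ?thesis by simp
next
  case (Suc j)
  have "(\<Sum>i\<in>I. l i * elsym_deriv k (I - {i}) l m)
      = (\<Sum>i\<in>I. \<Sum>s\<in>I. if s = i then 0 else l i * m s * elsym j (I - {i} - {s}) l)"
    using fin by (intro sum.cong refl) (auto simp: Suc sum_distrib_left sum.If_cases mult.assoc intro!: sum.mono_neutral_cong_left)
  also have "\<dots> = (\<Sum>s\<in>I. \<Sum>i\<in>I. if s = i then 0 else l i * m s * elsym j (I - {i} - {s}) l)"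
    by (rule sum.swap)
  also have "\<dots> = (\<Sum>s\<in>I. m s * (\<Sum>i\<in>I - {s}. l i * elsym j (I - {s} - {i}) l))"
  proof (intro sum.cong refl)
    fix s assume "s \<in> I"
    have "I - {s} - {i} = I - {i} - {s}" for i by auto
    then show "(\<Sum>i\<in>I. if s = i then 0 else l i * m s * elsym j (I - {i} - {s}) l)
       = m s * (\<Sum>i\<in>I - {s}. l i * elsym j (I - {s} - {i}) l)"
      using fin by (auto simp: sum_distrib_left ac_simps intro!: sum.mono_neutral_cong_right split: if_splits)
  qed
  also have "\<dots> = (\<Sum>s\<in>I. m s * (real k * elsym k (I - {s}) l))"
    using fin by (intro sum.cong refl) (simp add: elsym_euler Suc)
  also have "\<dots> = real k * elsym_deriv (Suc k) I l m"
    by (simp add: sum_distrib_left ac_simps)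
  finally show ?thesis by (simp add: sum.distrib algebra_simps)
qed

text \<open>The concavity of \<open>q\<^sub>k = e\<^sub>k\<^sub>+\<^sub>1 / e\<^sub>k\<close> on \<open>\<Gamma>\<^sub>k\<^sub>+\<^sub>1\<close>. As \<open>q\<^sub>k\<close> is homogeneous of degree 1, it
says that the derivative of \<open>q\<^sub>k\<close> at \<open>l\<close> in the direction \<open>m\<close> is at least \<open>q\<^sub>k(m)\<close>; here it is
multiplied by \<open>e\<^sub>k(l)\<^sup>2\<close>. Following Marcus and Lopes, \<open>q\<^sub>k\<^sub>+\<^sub>1\<close> is up to a positive factor the sum
of \<open>l i - (l i)\<^sup>2 / (l i + q\<^sub>k(I - {i}))\<close>, and \<open>x\<^sup>2 / y\<close> is convex and decreasing in \<open>y > 0\<close>.\<close>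
lemma marcus_lopes:
  assumes "finite I" "l \<in> Gamma_cone (Suc k) I" "m \<in> Gamma_cone (Suc k) I"
  shows "elsym (Suc k) I m / elsym k I m * (elsym k I l)\<^sup>2
    \<le> elsym_deriv (Suc k) I l m * elsym k I l - elsym (Suc k) I l * elsym_deriv k I l m"
  using assms
proof (induction k arbitrary: I)
  case 0
  then show ?case by (simp add: elsym_0 elsym_1)
next
  case (Suc k)
  note fin = Suc.prems(1)
  define A A' dA where "A = elsym (Suc k) I l" and "A' = elsym (Suc k) I m" and "dA = elsym_deriv (Suc k) I l m"
  define a b a' b' da db where "a i = elsym k (I - {i}) l" and "b i = elsym (Suc k) (I - {i}) l"
    and "a' i = elsym k (I - {i}) m" and "b' i = elsym (Suc k) (I - {i}) m"
    and "da i = elsym_deriv k (I - {i}) l m" and "db i = elsym_deriv (Suc k) (I - {i}) l m" for i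
  have A'pos: "A' > 0" using Gamma_cone_pos[OF fin Suc.prems(3)] by (simp add: A'_def)
  have summand: "m i * b' i * A\<^sup>2 / A' \<le> (m i * b i + l i * db i) * A - l i * b i * dA" if i: "i \<in> I" for i
  proof -
    have l: "l \<in> Gamma_cone (Suc k) (I - {i})" and m: "m \<in> Gamma_cone (Suc k) (I - {i})"
      using Gamma_cone_remove[OF fin i] Suc.prems by auto
    have pos: "a i > 0" "b i > 0" "a' i > 0" "b' i > 0"
      using Gamma_cone_pos[OF _ l] Gamma_cone_pos[OF _ m] fin by (auto simp: a_def b_def a'_def b'_def)
    have IH: "b' i / a' i * (a i)\<^sup>2 \<le> db i * a i - b i * da i"
      using Suc.IH[OF _ l m] fin by (simp add: a_def b_def a'_def b'_def da_def db_def)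
    have A: "A = l i * a i + b i" and A': "A' = m i * a' i + b' i"
      and dA: "dA = m i * a i + l i * da i + db i"
      using elsym_remove[OF fin i] elsym_deriv_remove[OF fin i]
      by (simp_all add: A_def A'_def dA_def a_def b_def a'_def b'_def da_def db_def)
    have "m i * b' i * A\<^sup>2 / A' \<le> m i * (b i)\<^sup>2 + (l i)\<^sup>2 * (b' i / a' i * (a i)\<^sup>2)"
    proof -
      \<comment> \<open>Convexity of \<open>x\<^sup>2 / y\<close> in the form of a perfect square.\<close>
      have "(m i * (b i)\<^sup>2 + (l i)\<^sup>2 * (b' i / a' i * (a i)\<^sup>2)) * A' - m i * b' i * A\<^sup>2
         = (m i * a' i * b i - l i * a i * b' i)\<^sup>2 / a' i"
        using pos unfolding A A' by (simp add: field_simps power2_eq_square)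
      also have "\<dots> \<ge> 0" using pos by simp
      finally show ?thesis using A'pos by (simp add: divide_le_eq)
    qed
    also have "\<dots> \<le> m i * (b i)\<^sup>2 + (l i)\<^sup>2 * (db i * a i - b i * da i)"
      using IH by (intro add_left_mono mult_left_mono) auto
    also have "\<dots> = (m i * b i + l i * db i) * A - l i * b i * dA"
      unfolding A dA by (simp add: algebra_simps power2_eq_square)
    finally show ?thesis .
  qed
  let ?N = "real (Suc (Suc k))"
  have euler: "(\<Sum>i\<in>I. m i * b' i) = ?N * elsym (Suc (Suc k)) I m"
    "(\<Sum>i\<in>I. l i * b i) = ?N * elsym (Suc (Suc k)) I l"
    "(\<Sum>i\<in>I. m i * b i + l i * db i) = ?N * elsym_deriv (Suc (Suc k)) I l m"
    unfolding b_def b'_def db_def by (rule elsym_euler[OF fin] elsym_deriv_euler[OF fin])+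
  have "?N * (elsym (Suc (Suc k)) I m / A' * A\<^sup>2) = (\<Sum>i\<in>I. m i * b' i) * A\<^sup>2 / A'"
    unfolding euler by (simp only: times_divide_eq_left times_divide_eq_right mult.assoc)
  also have "\<dots> = (\<Sum>i\<in>I. m i * b' i * A\<^sup>2 / A')"
    by (simp add: sum_distrib_right sum_divide_distrib)
  also have "\<dots> \<le> (\<Sum>i\<in>I. (m i * b i + l i * db i) * A - l i * b i * dA)"
    by (intro sum_mono summand)
  also have "\<dots> = (\<Sum>i\<in>I. m i * b i + l i * db i) * A - (\<Sum>i\<in>I. l i * b i) * dA"
    by (simp add: sum_subtractf sum_distrib_right)
  also have "\<dots> = ?N * (elsym_deriv (Suc (Suc k)) I l m * A - elsym (Suc (Suc k)) I l * dA)"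
    unfolding euler by (simp only: right_diff_distrib mult.assoc)
  finally have "elsym (Suc (Suc k)) I m / A' * A\<^sup>2
      \<le> elsym_deriv (Suc (Suc k)) I l m * A - elsym (Suc (Suc k)) I l * dA"
    by (rule mult_left_le_imp_le) simp
  then show ?case by (simp add: A_def A'_def dA_def del: elsym_deriv.simps)
qed

text \<open>The logarithm of \<open>e\<^sub>k\<close> is the telescoping sum of the logarithms of the concave quotients
\<open>e\<^sub>j\<^sub>+\<^sub>1 / e\<^sub>j\<close>; each contributes \<open>q(m) / q(l) \<ge> 1 + ln q(m) - ln q(l)\<close>.\<close>
lemma log_garding_inequality:
  assumes fin: "finite I" and "l \<in> Gamma_cone k I" "m \<in> Gamma_cone k I"
  shows "real k + ln (elsym k I m) - ln (elsym k I l) \<le> elsym_deriv k I l m / elsym k I l"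
  using assms(2,3)
proof (induction k)
  case 0 then show ?case using fin by (simp add: elsym_0)
next
  case (Suc k)
  define p q p' q' where "p = elsym k I l" "q = elsym (Suc k) I l" "p' = elsym k I m" "q' = elsym (Suc k) I m"
  define dp dq where "dp = elsym_deriv k I l m" and "dq = elsym_deriv (Suc k) I l m"
  note defs = p_q_p'_q'_def dp_def dq_def
  have pos: "p > 0" "q > 0" "p' > 0" "q' > 0"
    using Gamma_cone_pos[OF fin Suc.prems(1)] Gamma_cone_pos[OF fin Suc.prems(2)] by (auto simp: defs)
  have IH: "real k + ln p' - ln p \<le> dp / p"
    using Suc.IH Suc.prems Gamma_cone_mono[of _ "Suc k" I k] by (auto simp: defs)
  have mlo: "q' / p' * p\<^sup>2 \<le> dq * p - q * dp"
    using marcus_lopes[OF fin Suc.prems] by (simp only: defs)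
  have "(q' / p') * (p / q) = (q' / p' * p\<^sup>2) / (p * q)" using pos by (simp add: field_simps power2_eq_square)
  also have "\<dots> \<le> (dq * p - q * dp) / (p * q)" using mlo pos by (intro divide_right_mono) auto
  also have "\<dots> = dq / q - dp / p" using pos by (simp add: field_simps)
  finally have 1: "(q' / p') * (p / q) \<le> dq / q - dp / p" .
  have "ln ((q' / p') * (p / q)) \<le> (q' / p') * (p / q) - 1"
    using pos by (intro ln_le_minus_one) auto
  also have "ln ((q' / p') * (p / q)) = (ln q' - ln p') + (ln p - ln q)"
    using pos by (simp add: ln_mult ln_div)
  finally have "real (Suc k) + ln q' - ln q \<le> dq / q" using 1 IH by simp
  then show ?case by (simp add: defs)
qed

text \<open>The hyperplane tangent to the level set of \<open>e\<^sub>k\<^sub>+\<^sub>1\<close> through \<open>l\<close> has all of that level set within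
\<open>\<Gamma>\<^sub>k\<^sub>+\<^sub>1\<close> on one side.\<close>
lemma garding_vector:
  assumes fin: "finite I" and l: "l \<in> Gamma_cone (Suc k) I" and m: "m \<in> Gamma_cone (Suc k) I"
    and eq: "elsym (Suc k) I m = elsym (Suc k) I l"
  shows "real (Suc k) * elsym (Suc k) I l \<le> (\<Sum>i\<in>I. m i * elsym k (I - {i}) l)"
  using log_garding_inequality[OF assms(1-3)] Gamma_cone_pos[OF fin l, of "Suc k"]
  by (simp add: eq pos_le_divide_eq del: of_nat_Suc)

text \<open>A linear functional on doubly stochastic matrices is smallest at a permutation. To
find one, match the row \<open>a\<close> of the largest \<open>g\<close> with the column \<open>b\<close> of the smallest
\<open>m\<close>, and redistribute the mass that the row \<open>a\<close> and the column \<open>b\<close> had elsewhere over the remaining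
rows and columns as a product. This keeps the matrix doubly stochastic and does not increase the
functional, because \<open>g a\<close> is maximal and \<open>m b\<close> is minimal.\<close>
lemma doubly_stochastic_rearrangement:
  fixes g :: "'i \<Rightarrow> real" and m :: "'j \<Rightarrow> real" and S :: "'i \<Rightarrow> 'j \<Rightarrow> real"
  assumes "finite I" "finite J" "card I = card J"
    and "\<And>i j. i \<in> I \<Longrightarrow> j \<in> J \<Longrightarrow> 0 \<le> S i j"
    and "\<And>i. i \<in> I \<Longrightarrow> (\<Sum>j\<in>J. S i j) = 1" and "\<And>j. j \<in> J \<Longrightarrow> (\<Sum>i\<in>I. S i j) = 1"
  shows "\<exists>p. bij_betw p I J \<and> (\<Sum>i\<in>I. g i * m (p i)) \<le> (\<Sum>i\<in>I. \<Sum>j\<in>J. g i * S i j * m j)"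
  using assms
proof (induction "card I" arbitrary: I J S)
  case 0
  then have "I = {}" "J = {}" by auto
  then show ?case by (auto simp: bij_betw_def)
next
  case (Suc n)
  note fin = Suc.prems(1,2)
  have ne: "I \<noteq> {}" "J \<noteq> {}" using Suc.hyps(2) Suc.prems(3) by auto
  obtain a where a: "a \<in> I" "\<And>i. i \<in> I \<Longrightarrow> g i \<le> g a"
    using Max_in[of "g ` I"] Max_ge[of "g ` I"] fin ne by (metis (no_types, lifting) finite_imageI imageE image_eqI image_is_empty)
  obtain b where b: "b \<in> J" "\<And>j. j \<in> J \<Longrightarrow> m b \<le> m j"
    using Min_in[of "m ` J"] Min_le[of "m ` J"] fin ne by (metis (no_types, lifting) finite_imageI imageE image_eqI image_is_empty)
  define I' J' where "I' = I - {a}" and "J' = J - {b}"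
  have fin': "finite I'" "finite J'" using fin by (auto simp: I'_def J'_def)
  have I: "(\<Sum>i\<in>I. f i) = f a + (\<Sum>i\<in>I'. f i)" for f :: "'i \<Rightarrow> real"
    using fin a by (simp add: I'_def sum.remove)
  have J: "(\<Sum>j\<in>J. f j) = f b + (\<Sum>j\<in>J'. f j)" for f :: "'j \<Rightarrow> real"
    using fin b by (simp add: J'_def sum.remove)
  define s where "s = S a b"
  define R where "R i j = S i j + S i b * S a j / (1 - s)" for i j
  have row_a: "(\<Sum>j\<in>J'. S a j) = 1 - s" using Suc.prems(5)[OF a(1)] J[of "S a"] by (simp add: s_def)
  have col_b: "(\<Sum>i\<in>I'. S i b) = 1 - s" using Suc.prems(6)[OF b(1)] I[of "\<lambda>i. S i b"] by (simp add: s_def)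
  have nn: "0 \<le> S i j" if "i \<in> I" "j \<in> J" for i j using Suc.prems(4) that by auto
  have nna: "0 \<le> S a j" if "j \<in> J'" for j using that nn a by (auto simp: J'_def)
  have nnb: "0 \<le> S i b" if "i \<in> I'" for i using that nn b by (auto simp: I'_def)
  have s1: "s \<le> 1" using row_a sum_nonneg[of J' "S a"] nna by simp
  \<comment> \<open>If \<open>s = 1\<close>, nothing is redistributed, and the quotient in \<open>R\<close> is 0 by convention.\<close>
  have col0: "S i b = 0" if "s = 1" "i \<in> I'" for i
    using that col_b fin' nnb by (simp add: sum_nonneg_eq_0_iff)
  have row0: "S a j = 0" if "s = 1" "j \<in> J'" for j
    using that row_a fin' nna by (simp add: sum_nonneg_eq_0_iff)
  have IR: "\<exists>p. bij_betw p I' J' \<and> (\<Sum>i\<in>I'. g i * m (p i)) \<le> (\<Sum>i\<in>I'. \<Sum>j\<in>J'. g i * R i j * m j)"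
  proof (rule Suc.hyps(1))
    show "n = card I'" "card I' = card J'" using Suc.hyps(2) Suc.prems(3) a b fin by (auto simp: I'_def J'_def)
    show "0 \<le> R i j" if "i \<in> I'" "j \<in> J'" for i j
      using that nn nna nnb s1 by (auto simp: R_def I'_def J'_def)
    show "(\<Sum>j\<in>J'. R i j) = 1" if i: "i \<in> I'" for i
    proof -
      have "(\<Sum>j\<in>J'. R i j) = (\<Sum>j\<in>J'. S i j) + S i b * (\<Sum>j\<in>J'. S a j) / (1 - s)"
        by (simp add: R_def sum.distrib sum_distrib_left sum_divide_distrib)
      also have "\<dots> = (\<Sum>j\<in>J'. S i j) + S i b"
        unfolding row_a using col0[OF _ i] by (cases "s = 1") auto
      also have "\<dots> = 1" using Suc.prems(5)[of i] J[of "S i"] i by (simp add: I'_def)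
      finally show ?thesis .
    qed
    show "(\<Sum>i\<in>I'. R i j) = 1" if j: "j \<in> J'" for j
    proof -
      have "(\<Sum>i\<in>I'. R i j) = (\<Sum>i\<in>I'. S i j) + (\<Sum>i\<in>I'. S i b) * S a j / (1 - s)"
        by (simp add: R_def sum.distrib sum_distrib_right sum_divide_distrib)
      also have "\<dots> = (\<Sum>i\<in>I'. S i j) + S a j"
        unfolding col_b using row0[OF _ j] by (cases "s = 1") auto
      also have "\<dots> = 1" using Suc.prems(6)[of j] I[of "\<lambda>i. S i j"] j by (simp add: J'_def)
      finally show ?thesis .
    qed
  qed (use fin' in auto)
  then obtain p where p: "bij_betw p I' J'"
    "(\<Sum>i\<in>I'. g i * m (p i)) \<le> (\<Sum>i\<in>I'. \<Sum>j\<in>J'. g i * R i j * m j)" by blast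
  define p' where "p' = p(a := b)"
  have p'I: "p' i = p i" if "i \<in> I'" for i using that by (auto simp: p'_def I'_def)
  have "bij_betw p' I' J'" using p(1) p'I by (simp cong: bij_betw_cong)
  then have "bij_betw p' (I' \<union> {a}) (J' \<union> {p' a})"
    by (intro notIn_Un_bij_betw) (auto simp: I'_def J'_def p'_def)
  then have bij: "bij_betw p' I J"
    using a(1) b(1) by (simp add: p'_def I'_def J'_def insert_absorb)
  define G M where "G = (\<Sum>i\<in>I'. g i * S i b)" and "M = (\<Sum>j\<in>J'. S a j * m j)"
  have G: "G \<le> g a * (1 - s)"
    unfolding col_b[symmetric] G_def sum_distrib_left
    using a(2) nnb by (intro sum_mono mult_right_mono) (auto simp: I'_def)
  have M: "m b * (1 - s) \<le> M"
    unfolding row_a[symmetric] M_def sum_distrib_left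
    using b(2) nna unfolding mult.commute[of "m b"] by (intro sum_mono mult_left_mono) (auto simp: J'_def)
  have swap: "g a * m b * (1 - s) + G * M / (1 - s) \<le> g a * M + m b * G"
  proof (cases "s = 1")
    case True
    then show ?thesis using row0 col0 by (simp add: G_def M_def)
  next
    case False
    then have t: "1 - s > 0" using s1 by simp
    have "0 \<le> (g a * (1 - s) - G) * (M - m b * (1 - s)) / (1 - s)"
      using G M t by simp
    also have "\<dots> = g a * M + m b * G - (g a * m b * (1 - s) + G * M / (1 - s))"
      using t by (simp add: field_simps)
    finally show ?thesis by simp
  qed
  have "(\<Sum>i\<in>I. g i * m (p' i)) = g a * m b + (\<Sum>i\<in>I'. g i * m (p i))"
    unfolding I by (simp add: p'_def I'_def)
  also have "\<dots> \<le> g a * m b + (\<Sum>i\<in>I'. \<Sum>j\<in>J'. g i * R i j * m j)"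
    using p(2) by simp
  also have "(\<Sum>i\<in>I'. \<Sum>j\<in>J'. g i * R i j * m j)
      = (\<Sum>i\<in>I'. \<Sum>j\<in>J'. g i * S i j * m j) + G * M / (1 - s)"
    by (simp add: R_def G_def M_def sum_product sum_divide_distrib sum.distrib[symmetric] algebra_simps)
  also have "g a * m b + ((\<Sum>i\<in>I'. \<Sum>j\<in>J'. g i * S i j * m j) + G * M / (1 - s))
      \<le> g a * s * m b + g a * M + (G * m b + (\<Sum>i\<in>I'. \<Sum>j\<in>J'. g i * S i j * m j))"
    using swap by (simp add: algebra_simps)
  also have "\<dots> = (\<Sum>i\<in>I. \<Sum>j\<in>J. g i * S i j * m j)"
    unfolding I J by (simp add: sum.distrib G_def M_def sum_distrib_left sum_distrib_right s_def ac_simps)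
  finally show ?case using bij by blast
qed

section \<open>Garding's inequality for Hermitian matrices\<close>

definition adjoint_matrix :: "complex ^ 'n ^ 'm \<Rightarrow> complex ^ 'm ^ 'n" where
  "adjoint_matrix M = (\<chi> i j. cnj (M $ j $ i))"

definition hermitian :: "complex ^ 'n ^ 'n \<Rightarrow> bool" where
  "hermitian A \<longleftrightarrow> adjoint_matrix A = A"

definition real_diag :: "('n \<Rightarrow> real) \<Rightarrow> complex ^ 'n ^ 'n" where
  "real_diag l = (\<chi> i j. if i = j then complex_of_real (l i) else 0)"

text \<open>The first index of \<open>A\<close> is paired with \<open>x\<close> and the second one with its conjugate, as in the Levi form. So the
eigenvectors of \<open>A\<close> enter this form conjugated.\<close>
definition hermitian_form :: "complex ^ 'n::finite ^ 'n \<Rightarrow> complex ^ 'n \<Rightarrow> real" where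
  "hermitian_form A x = Re (\<Sum>i\<in>UNIV. \<Sum>j\<in>UNIV. A $ i $ j * x $ i * cnj (x $ j))"

lemma inner_eq_Re_cinner: "inner v w = Re (cinner v w)"
  by (simp add: cinner_def inner_vec_def inner_complex_def)

lemma hermitian_entry: "hermitian A \<Longrightarrow> cnj (A $ j $ i) = A $ i $ j"
  by (simp add: hermitian_def adjoint_matrix_def vec_eq_iff)

lemma cinner_hermitian:
  assumes "hermitian A" shows "cinner (A *v v) w = cinner v (A *v w)"
proof -
  have "cinner (A *v v) w = (\<Sum>i\<in>UNIV. \<Sum>j\<in>UNIV. A $ i $ j * v $ j * cnj (w $ i))"
    by (simp add: cinner_def matrix_vector_mult_def sum_distrib_right)
  also have "\<dots> = (\<Sum>j\<in>UNIV. \<Sum>i\<in>UNIV. A $ i $ j * v $ j * cnj (w $ i))" by (rule sum.swap)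
  also have "\<dots> = cinner v (A *v w)"
    using hermitian_entry[OF assms]
    by (simp add: cinner_def matrix_vector_mult_def sum_distrib_left ac_simps)
  finally show ?thesis .
qed

lemma cinner_scale_right: "cinner v (c *s w) = cnj c * cinner v w"
  by (simp add: cinner_def sum_distrib_left ac_simps)

lemma cinner_add_scaleR_left: "cinner (v + r *\<^sub>R w) x = cinner v x + r *\<^sub>R cinner w x"
  by (simp add: cinner_def sum.distrib ring_distribs scaleR_sum_right)

lemma cinner_swap: "cinner w v = cnj (cinner v w)"
  by (simp add: cinner_def mult.commute)

lemma cinner_self: "cinner v v = complex_of_real ((norm v)\<^sup>2)"
proof (rule complex_eqI)
  show "Re (cinner v v) = Re (complex_of_real ((norm v)\<^sup>2))"
    by (simp add: inner_eq_Re_cinner[symmetric] power2_norm_eq_inner)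
  show "Im (cinner v v) = Im (complex_of_real ((norm v)\<^sup>2))"
    by (simp add: cinner_def mult.commute)
qed

lemma matrix_vector_mult_scaleR_complex: "(A :: complex ^ 'n ^ 'm) *v (r *\<^sub>R v) = r *\<^sub>R (A *v v)"
  by (simp add: matrix_vector_mult_def vec_eq_iff scaleR_sum_right)

lemma continuous_on_matrix_vector_mult [continuous_intros]:
  "continuous_on S f \<Longrightarrow> continuous_on S (\<lambda>x. (A :: complex ^ 'n ^ 'm) *v f x)"
  unfolding matrix_vector_mult_def by (intro continuous_intros)

text \<open>A maximum point of the real quadratic form \<open>inner (A v) v\<close> on the unit sphere of the orthogonal
complement of the given eigenvectors is an eigenvector. The complement is nonzero by a count of real
dimensions: \<open>m\<close> complex orthogonality conditions are \<open>2 m\<close> real ones.\<close>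
lemma hermitian_eigenvector_orthogonal:
  fixes A :: "complex ^ 'n::finite ^ 'n" and S :: "'n set"
  assumes A: "hermitian A" and S: "card S < CARD('n)"
    and eig: "\<And>i. i \<in> S \<Longrightarrow> A *v e i = complex_of_real (l i) *s e i"
  obtains v c where "norm v = 1" "\<And>i. i \<in> S \<Longrightarrow> cinner v (e i) = 0" "A *v v = complex_of_real c *s v"
proof -
  have finS: "finite (S :: 'n set)" by simp
  define V where "V = {v. \<forall>i\<in>S. cinner v (e i) = 0}"
  have sub: "v + r *\<^sub>R w \<in> V" if "v \<in> V" "w \<in> V" for v w r
    using that by (simp add: V_def cinner_add_scaleR_left)
  have inv: "A *v v \<in> V" if "v \<in> V" for v
    using that by (simp add: V_def cinner_hermitian[OF A] eig cinner_scale_right)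
  have scale: "r *\<^sub>R v \<in> V" if "v \<in> V" for v r
    using sub[where v = 0, OF _ that, where r = r] by (simp add: V_def cinner_def)
  define E where "E = e ` S \<union> (\<lambda>i. \<i> *s e i) ` S"
  have "dim E \<le> card E" by (intro dim_le_card') (simp add: E_def)
  also have "\<dots> \<le> card (e ` S) + card ((\<lambda>i. \<i> *s e i) ` S)" unfolding E_def by (rule card_Un_le)
  also have "\<dots> \<le> card S + card S" by (intro add_mono card_image_le finS)
  also have "\<dots> < DIM(complex ^ 'n)" using S by simp
  finally obtain x where x: "x \<noteq> 0" "\<And>y. y \<in> span E \<Longrightarrow> orthogonal x y"
    using orthogonal_to_subspace_exists by blast
  have "cinner x (e i) = 0" if i: "i \<in> S" for i
  proof (rule complex_eqI)
    have "inner x (e i) = 0" "inner x (\<i> *s e i) = 0"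
      using x(2) i span_base[of _ E] unfolding orthogonal_def E_def by blast+
    then show "Re (cinner x (e i)) = Re 0" "Im (cinner x (e i)) = Im 0"
      by (simp_all add: inner_eq_Re_cinner cinner_scale_right)
  qed
  then have "(1 / norm x) *\<^sub>R x \<in> V" by (intro scale) (simp add: V_def)
  then have ne: "V \<inter> sphere 0 1 \<noteq> {}" using x(1) by (auto intro!: exI[of _ "(1 / norm x) *\<^sub>R x"])
  have "V = (\<Inter>i\<in>S. {v. cinner v (e i) = 0})" by (auto simp: V_def)
  also have "closed \<dots>"
    unfolding cinner_def by (intro closed_INT ballI closed_Collect_eq continuous_intros)
  finally have comp: "compact (V \<inter> sphere 0 1)" by (intro closed_Int_compact compact_sphere)
  have "continuous_on (V \<inter> sphere 0 1) (\<lambda>v. inner (A *v v) v)" by (intro continuous_intros)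
  from continuous_attains_sup[OF comp ne this]
  obtain v where "v \<in> V \<inter> sphere 0 1"
    and max': "\<forall>y\<in>V \<inter> sphere 0 1. inner (A *v y) y \<le> inner (A *v v) v" by blast
  then have v: "v \<in> V" "norm v = 1" by simp_all
  have max: "inner (A *v y) y \<le> inner (A *v v) v" if "y \<in> V" "norm y = 1" for y
    using that max' by simp
  define c where "c = inner (A *v v) v"
  have bound: "inner (A *v y) y \<le> c * (norm y)\<^sup>2" if y: "y \<in> V" for y
  proof (cases "y = 0")
    case False
    have "inner (A *v ((1 / norm y) *\<^sub>R y)) ((1 / norm y) *\<^sub>R y) \<le> c"
      unfolding c_def using y False by (intro max scale) auto
    then show ?thesis
      using False by (simp add: matrix_vector_mult_scaleR_complex power2_eq_square divide_le_eq)
  qed (simp add: matrix_vector_mult_0_right)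
  define w where "w = A *v v - c *\<^sub>R v"
  have wV: "w \<in> V" using sub[OF inv[OF v(1)] v(1), where r = "- c"] by (simp add: w_def)
  define K where "K = c * (norm w)\<^sup>2 - inner (A *v w) w"
  have K: "K \<ge> 0" using bound[OF wV] by (simp add: K_def)
  \<comment> \<open>Maximality at \<open>v\<close>, tested on \<open>v + t w\<close>.\<close>
  have ineq: "2 * (norm w)\<^sup>2 \<le> t * K" if t: "t > 0" for t
  proof -
    have sym: "inner (A *v w) v = inner (A *v v) w"
      by (metis A cinner_hermitian inner_commute inner_eq_Re_cinner)
    have wv: "inner (A *v v) w - c * inner v w = (norm w)\<^sup>2"
      by (simp add: w_def power2_norm_eq_inner inner_diff_left inner_diff_right algebra_simps inner_commute)
    have "0 \<le> c * (norm (v + t *\<^sub>R w))\<^sup>2 - inner (A *v (v + t *\<^sub>R w)) (v + t *\<^sub>R w)"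
      using bound[OF sub[OF v(1) wV]] by simp
    also have "\<dots> = c * (norm v)\<^sup>2 - inner (A *v v) v - 2 * t * (inner (A *v v) w - c * inner v w) + t\<^sup>2 * K"
      unfolding matrix_vector_right_distrib matrix_vector_mult_scaleR_complex K_def power2_norm_eq_inner
      by (simp add: inner_add_left inner_add_right sym inner_commute[of w v] algebra_simps power2_eq_square)
    also have "\<dots> = t * (t * K - 2 * (norm w)\<^sup>2)"
      unfolding wv using v(2) by (simp add: c_def power2_eq_square algebra_simps)
    finally show ?thesis using t by (simp add: zero_le_mult_iff)
  qed
  have "w = 0"
  proof (rule ccontr)
    assume "w \<noteq> 0"
    then have "2 * (norm w)\<^sup>2 \<le> (norm w)\<^sup>2 / (K + 1) * K" using K by (intro ineq) auto
    also have "\<dots> = (norm w)\<^sup>2 * (K / (K + 1))" by simp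
    also have "\<dots> \<le> (norm w)\<^sup>2 * 1" using K by (intro mult_left_mono) auto
    finally show False using \<open>w \<noteq> 0\<close> by simp
  qed
  then have "A *v v = c *\<^sub>R v" by (simp add: w_def)
  also have "\<dots> = complex_of_real c *s v"
    unfolding vec_eq_iff vector_scaleR_component vector_smult_component by (simp add: scaleR_conv_of_real)
  finally have "A *v v = complex_of_real c *s v" .
  with v that show thesis by (auto simp: V_def)
qed

lemma hermitian_eigenbasis:
  fixes A :: "complex ^ 'n::finite ^ 'n" and S :: "'n set"
  assumes A: "hermitian A"
  shows "\<exists>e l. \<forall>i\<in>S. A *v e i = complex_of_real (l i) *s e i \<and>
     (\<forall>j\<in>S. cinner (e i) (e j) = (if i = j then 1 else 0))"
  (is "\<exists>e l. ?P S e l")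
proof -
  have "finite (S :: 'n set)" by simp
  then show ?thesis
  proof (induction S rule: finite_induct)
    case (insert a S)
    then obtain e l where el: "?P S e l" by blast
    have "S \<noteq> UNIV" using insert.hyps(2) by auto
    then have "card S < CARD('n)" by (simp add: psubset_card_mono psubset_eq)
    then obtain v c where v: "norm v = 1" "\<And>i. i \<in> S \<Longrightarrow> cinner v (e i) = 0" "A *v v = complex_of_real c *s v"
      using hermitian_eigenvector_orthogonal[OF A, of S e l] el by metis
    have "cinner (e i) v = 0" if "i \<in> S" for i using v(2)[OF that] cinner_swap[of "e i" v] by simp
    moreover have "cinner v v = 1" using v(1) by (simp add: cinner_self)
    ultimately have "?P (insert a S) (e(a := v)) (l(a := c))"
      using el v insert.hyps(2) by auto
    then show ?case by blast
  qed simp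
qed

lemma adjoint_matrix_mult: "adjoint_matrix (A ** B) = adjoint_matrix B ** adjoint_matrix A"
  by (simp add: adjoint_matrix_def matrix_matrix_mult_def vec_eq_iff mult.commute)

lemma adjoint_matrix_adjoint: "adjoint_matrix (adjoint_matrix A) = A"
  by (simp add: adjoint_matrix_def vec_eq_iff)

definition unitary :: "complex ^ 'n ^ 'n \<Rightarrow> bool" where
  "unitary U \<longleftrightarrow> adjoint_matrix U ** U = mat 1"

lemma unitary_right: "unitary (U :: complex ^ 'n::finite ^ 'n) \<Longrightarrow> U ** adjoint_matrix U = mat 1"
  by (simp add: unitary_def matrix_left_right_inverse)

lemma spectral_theorem:
  fixes A :: "complex ^ 'n::finite ^ 'n"
  assumes A: "hermitian A"
  obtains U l where "unitary U" "A = U ** real_diag l ** adjoint_matrix U"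
proof -
  obtain e :: "'n \<Rightarrow> complex ^ 'n" and l where "\<forall>i\<in>UNIV. A *v e i = complex_of_real (l i) *s e i \<and>
     (\<forall>j\<in>UNIV. cinner (e i) (e j) = (if i = j then 1 else 0))"
    using hermitian_eigenbasis[OF A, of UNIV] by blast
  then have el: "A *v e i = complex_of_real (l i) *s e i"
    "cinner (e i) (e j) = (if i = j then 1 else 0)" for i j
    by simp_all
  define U where "U = (\<chi> a i. e i $ a)"
  have "(adjoint_matrix U ** U) $ i $ j = cinner (e j) (e i)" for i j
    by (simp add: adjoint_matrix_def matrix_matrix_mult_def U_def cinner_def mult.commute)
  then have U: "unitary U" by (auto simp: unitary_def vec_eq_iff el mat_def)
  have "(A ** U) $ i $ j = (A *v e j) $ i" for i j
    by (simp add: matrix_matrix_mult_def U_def matrix_vector_mult_def)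
  then have "A ** U = U ** real_diag l"
    by (simp add: vec_eq_iff el) (simp add: matrix_matrix_mult_def U_def real_diag_def if_distrib sum.delta mult.commute cong: if_cong)
  then have "A ** (U ** adjoint_matrix U) = U ** real_diag l ** adjoint_matrix U"
    by (simp add: matrix_mul_assoc)
  then have "A = U ** real_diag l ** adjoint_matrix U" by (simp add: unitary_right[OF U])
  with U that show thesis by blast
qed

lemma matrix_diff_ldistrib: "A ** (B - C) = A ** B - A ** (C :: complex ^ 'n ^ 'm)"
  by (simp add: matrix_matrix_mult_def vec_eq_iff right_diff_distrib sum_subtractf)

lemma matrix_diff_rdistrib: "(B - C) ** A = B ** A - (C :: complex ^ 'n ^ 'm) ** A"
  by (simp add: matrix_matrix_mult_def vec_eq_iff left_diff_distrib sum_subtractf)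

lemma charpoly_unitary_conj:
  fixes H :: "complex ^ 'n::finite ^ 'n"
  assumes "unitary Y"
  shows "det (mat t - Y ** H ** adjoint_matrix Y) = det (mat t - H)"
proof -
  have Y: "Y ** adjoint_matrix Y = mat 1" by (rule unitary_right[OF assms])
  have comm: "Y ** mat t = mat t ** Y"
    by (simp add: matrix_matrix_mult_def mat_def vec_eq_iff if_distrib if_distribR sum.delta sum.delta' mult.commute cong: if_cong)
  have "Y ** mat t ** adjoint_matrix Y = mat t"
    unfolding comm by (simp add: matrix_mul_assoc[symmetric] Y)
  then have "mat t - Y ** H ** adjoint_matrix Y = Y ** (mat t - H) ** adjoint_matrix Y"
    by (simp add: matrix_diff_ldistrib matrix_diff_rdistrib)
  then have "det (mat t - Y ** H ** adjoint_matrix Y) = (det Y * det (adjoint_matrix Y)) * det (mat t - H)"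
    by (simp add: det_mul)
  also have "det Y * det (adjoint_matrix Y) = 1" using Y by (metis det_I det_mul)
  finally show ?thesis by simp
qed

lemma eigenvalues_unitary_conj:
  "unitary Y \<Longrightarrow> eigenvalues (Y ** H ** adjoint_matrix Y) = eigenvalues H"
  by (simp add: eigenvalues_def charpoly_unitary_conj)

text \<open>Expresses \<open>elsym\<close> by the polynomial with the roots \<open>- x i\<close>, so that it is determined by the values of
that polynomial.\<close>
lemma elsym_eq_coeff:
  fixes x :: "'i \<Rightarrow> 'a::idom"
  assumes "finite I"
  shows "elsym k I x = coeff (reflect_poly (\<Prod>i\<in>I. [:x i, 1:])) k"
proof -
  have refl: "reflect_poly [:a, 1:] = [:1, a:]" for a :: 'a
    by (simp add: reflect_poly_def)
  have "elsym k I x = coeff (\<Prod>i\<in>I. [:1, x i:]) k"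
    using assms
  proof (induction I arbitrary: k rule: finite_induct)
    case empty then show ?case by (cases k) (auto simp: elsym_0 elsym_eq_0)
  next
    case (insert a I)
    then show ?case by (cases k) (simp_all add: elsym_0 elsym_insert coeff_pCons insert.IH[symmetric])
  qed
  then show ?thesis by (simp add: reflect_poly_prod refl)
qed

text \<open>The family \<open>eigenvalues A\<close> is some factorization of the characteristic polynomial, while \<open>l\<close> comes
from a diagonalization: they agree only up to order, but their symmetric functions are coefficients of the
same polynomial.\<close>
lemma esym_eigenvalues:
  fixes A :: "complex ^ 'n::finite ^ 'n"
  assumes U: "unitary U" and A: "A = U ** real_diag l ** adjoint_matrix U"
  shows "esym k UNIV (eigenvalues A) = elsym k UNIV l"
proof -
  have charpoly: "det (mat t - A) = (\<Prod>i\<in>UNIV. t - complex_of_real (l i))" for t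
    unfolding A charpoly_unitary_conj[OF U]
    by (subst det_diagonal) (auto simp: real_diag_def mat_def)
  have ex: "\<exists>l :: 'n \<Rightarrow> real. \<forall>t. det (mat t - A) = (\<Prod>i\<in>UNIV. t - complex_of_real (l i))" by (intro exI[of _ l] allI charpoly)
  have "\<forall>t. det (mat t - A) = (\<Prod>i\<in>UNIV. t - complex_of_real (eigenvalues A i))"
    unfolding eigenvalues_def by (rule someI_ex[OF ex])
  then have "(\<Prod>i\<in>UNIV. t - complex_of_real (eigenvalues A i)) = (\<Prod>i\<in>UNIV. t - complex_of_real (l i))" for t
    unfolding charpoly by metis
  then have "(\<Prod>i\<in>UNIV. - t - complex_of_real (eigenvalues A i)) = (\<Prod>i\<in>UNIV. - t - complex_of_real (l i))" for t
    by blast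
  then have "(\<Prod>i\<in>UNIV. - (t + complex_of_real (eigenvalues A i))) = (\<Prod>i\<in>UNIV. - (t + complex_of_real (l i)))" for t
    by simp
  then have "(\<Prod>i\<in>UNIV. t + complex_of_real (eigenvalues A i)) = (\<Prod>i\<in>UNIV. t + complex_of_real (l i))" for t
    unfolding prod_uminus by simp
  then have "poly (\<Prod>i\<in>UNIV. [:complex_of_real (eigenvalues A i), 1:]) = poly (\<Prod>i\<in>UNIV. [:complex_of_real (l i), 1:])"
    by (simp add: fun_eq_iff poly_prod add.commute)
  then have "(\<Prod>i\<in>UNIV. [:complex_of_real (eigenvalues A i), 1:]) = (\<Prod>i\<in>UNIV. [:complex_of_real (l i), 1:])"
    by (simp add: poly_eq_poly_eq_iff)
  then have "elsym k UNIV (\<lambda>i. complex_of_real (eigenvalues A i)) = elsym k UNIV (\<lambda>i. complex_of_real (l i))"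
    by (simp add: elsym_eq_coeff)
  then show ?thesis by (simp add: elsym_of_real esym_eq_elsym)
qed

lemma spectral_entry:
  "(U ** real_diag l ** adjoint_matrix U) $ i $ j = (\<Sum>a\<in>UNIV. U $ i $ a * of_real (l a) * cnj (U $ j $ a))"
  by (simp add: matrix_matrix_mult_def real_diag_def adjoint_matrix_def if_distrib sum.delta cong: if_cong)

lemma hermitian_form_spectral:
  fixes U :: "complex ^ 'n::finite ^ 'n"
  shows "hermitian_form (U ** real_diag l ** adjoint_matrix U) x
    = (\<Sum>a\<in>UNIV. l a * (cmod (\<Sum>i\<in>UNIV. U $ i $ a * x $ i))\<^sup>2)"
proof -
  have "(\<Sum>i\<in>UNIV. \<Sum>j\<in>UNIV. (U ** real_diag l ** adjoint_matrix U) $ i $ j * x $ i * cnj (x $ j))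
     = (\<Sum>i\<in>UNIV. \<Sum>j\<in>UNIV. \<Sum>a\<in>UNIV. of_real (l a) * (U $ i $ a * x $ i) * cnj (U $ j $ a * x $ j))"
    unfolding spectral_entry by (simp add: sum_distrib_right sum_distrib_left ac_simps)
  also have "\<dots> = (\<Sum>i\<in>UNIV. \<Sum>a\<in>UNIV. \<Sum>j\<in>UNIV. of_real (l a) * (U $ i $ a * x $ i) * cnj (U $ j $ a * x $ j))"
    by (intro sum.cong refl sum.swap)
  also have "\<dots> = (\<Sum>a\<in>UNIV. \<Sum>i\<in>UNIV. \<Sum>j\<in>UNIV. of_real (l a) * (U $ i $ a * x $ i) * cnj (U $ j $ a * x $ j))"
    by (rule sum.swap)
  also have "\<dots> = (\<Sum>a\<in>UNIV. of_real (l a) * ((\<Sum>i\<in>UNIV. U $ i $ a * x $ i) * cnj (\<Sum>i\<in>UNIV. U $ i $ a * x $ i)))"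
    unfolding cnj_sum sum_product by (simp only: sum_distrib_left mult.assoc complex_cnj_mult)
  also have "\<dots> = of_real (\<Sum>a\<in>UNIV. l a * (cmod (\<Sum>i\<in>UNIV. U $ i $ a * x $ i))\<^sup>2)"
    by (simp only: complex_norm_square of_real_sum of_real_mult)
  finally show ?thesis by (simp only: hermitian_form_def Re_complex_of_real)
qed

lemma unitary_row_sum:
  assumes "unitary (W :: complex ^ 'n::finite ^ 'n)"
  shows "(\<Sum>a\<in>UNIV. (cmod (W $ b $ a))\<^sup>2) = 1" and "(\<Sum>a\<in>UNIV. (cmod (W $ a $ b))\<^sup>2) = 1"
proof -
  have "complex_of_real (\<Sum>a\<in>UNIV. (cmod (W $ b $ a))\<^sup>2) = (W ** adjoint_matrix W) $ b $ b"
    by (simp add: matrix_matrix_mult_def adjoint_matrix_def complex_norm_square del: of_real_power)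
  also have "\<dots> = complex_of_real 1" by (simp add: unitary_right[OF assms] mat_def)
  finally show "(\<Sum>a\<in>UNIV. (cmod (W $ b $ a))\<^sup>2) = 1" by (simp only: of_real_eq_iff)
  have "complex_of_real (\<Sum>a\<in>UNIV. (cmod (W $ a $ b))\<^sup>2) = (adjoint_matrix W ** W) $ b $ b"
    by (simp add: matrix_matrix_mult_def adjoint_matrix_def complex_norm_square mult.commute del: of_real_power)
  also have "\<dots> = complex_of_real 1" using assms by (simp add: unitary_def mat_def)
  finally show "(\<Sum>a\<in>UNIV. (cmod (W $ a $ b))\<^sup>2) = 1" by (simp only: of_real_eq_iff)
qed

text \<open>The functional \<open>B \<mapsto> \<Sum>i. g i * hermitian_form B (x i)\<close> is the derivative of \<open>\<sigma>\<^sub>k\<^sub>+\<^sub>1\<close> at \<open>A\<close>,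
written in an orthonormal eigenbasis of \<open>A\<close>. The diagonal of \<open>B\<close> in this basis is the image of the
eigenvalues of \<open>B\<close> under a doubly stochastic matrix, so by rearrangement it suffices to compare \<open>A\<close> with
matrices that are diagonal in the same basis; these are covered by the inequality for vectors.\<close>
lemma garding_matrix:
  fixes A :: "complex ^ 'n::finite ^ 'n"
  assumes A: "hermitian A" "eigenvalues A \<in> Gamma_cone (Suc k) UNIV"
  obtains g :: "'n \<Rightarrow> real" and x :: "'n \<Rightarrow> complex ^ 'n"
  where "\<forall>i. 0 \<le> g i"
    and "(\<Sum>i\<in>UNIV. g i * hermitian_form A (x i)) = real (Suc k) * sigma (Suc k) A"
    and "\<forall>B. hermitian B \<and> eigenvalues B \<in> Gamma_cone (Suc k) UNIV \<and> sigma (Suc k) B = sigma (Suc k) A \<longrightarrow>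
      (\<Sum>i\<in>UNIV. g i * hermitian_form A (x i)) \<le> (\<Sum>i\<in>UNIV. g i * hermitian_form B (x i))"
proof -
  obtain U l where U: "unitary U" and AU: "A = U ** real_diag l ** adjoint_matrix U"
    using spectral_theorem[OF A(1)] .
  have es: "esym j UNIV (eigenvalues A) = elsym j UNIV l" for j by (rule esym_eigenvalues[OF U AU])
  then have l: "l \<in> Gamma_cone (Suc k) UNIV"
    using A(2) by (auto simp: Gamma_cone_elsym esym_eq_elsym)
  define x :: "'n \<Rightarrow> complex ^ 'n" where "x b = (\<chi> i. cnj (U $ i $ b))" for b
  define g :: "'n \<Rightarrow> real" where "g i = elsym k (UNIV - {i}) l" for i
  have form: "hermitian_form (V ** real_diag m ** adjoint_matrix V) (x b)
     = (\<Sum>a\<in>UNIV. (cmod ((adjoint_matrix U ** V) $ b $ a))\<^sup>2 * m a)" for V :: "complex ^ 'n ^ 'n" and m b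
    unfolding hermitian_form_spectral by (simp add: x_def adjoint_matrix_def matrix_matrix_mult_def mult.commute)
  have "hermitian_form A (x b) = l b" for b
    unfolding AU form using U by (simp add: unitary_def mat_def if_distrib[of cmod] if_distrib[of "\<lambda>t. t\<^sup>2"] if_distribR sum.delta' if_distrib[of "\<lambda>t. t * _"] cong: if_cong)
  then have gA: "(\<Sum>i\<in>UNIV. g i * hermitian_form A (x i)) = real (Suc k) * elsym (Suc k) UNIV l"
    using elsym_euler[of UNIV l k] by (simp add: g_def mult.commute)
  have gpos: "g i \<ge> 0" for i
    using Gamma_cone_pos[OF _ Gamma_cone_remove[OF _ _ l, of i], of k] by (simp add: g_def)
  show thesis
  proof (rule that[of g x])
    show "(\<Sum>i\<in>UNIV. g i * hermitian_form A (x i)) = real (Suc k) * sigma (Suc k) A"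
      by (simp only: gA sigma_def es)
    show "\<forall>B. hermitian B \<and> eigenvalues B \<in> Gamma_cone (Suc k) UNIV \<and> sigma (Suc k) B = sigma (Suc k) A \<longrightarrow>
      (\<Sum>i\<in>UNIV. g i * hermitian_form A (x i)) \<le> (\<Sum>i\<in>UNIV. g i * hermitian_form B (x i))"
    proof (intro allI impI, elim conjE)
      fix B :: "complex ^ 'n ^ 'n" assume B: "hermitian B" "eigenvalues B \<in> Gamma_cone (Suc k) UNIV" "sigma (Suc k) B = sigma (Suc k) A"
      obtain V m where V: "unitary V" and BV: "B = V ** real_diag m ** adjoint_matrix V"
        using spectral_theorem[OF B(1)] .
      have esB: "esym j UNIV (eigenvalues B) = elsym j UNIV m" for j by (rule esym_eigenvalues[OF V BV])
      define W where "W = adjoint_matrix U ** V"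
      have "adjoint_matrix W ** W = adjoint_matrix V ** (U ** adjoint_matrix U) ** V"
        by (simp add: W_def adjoint_matrix_mult adjoint_matrix_adjoint matrix_mul_assoc)
      then have W: "unitary W" using V by (simp add: unitary_right[OF U] unitary_def)
      obtain p where p: "bij p" "(\<Sum>i\<in>UNIV. g i * m (p i)) \<le> (\<Sum>i\<in>UNIV. \<Sum>j\<in>UNIV. g i * (cmod (W $ i $ j))\<^sup>2 * m j)"
        using doubly_stochastic_rearrangement[of "UNIV :: 'n set" "UNIV :: 'n set" "\<lambda>i j. (cmod (W $ i $ j))\<^sup>2" g m]
          unitary_row_sum[OF W] by auto
      have esm: "elsym j UNIV (\<lambda>i. m (p i)) = esym j UNIV (eigenvalues B)" for j
        using elsym_reindex[OF p(1)] esB by simp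
      then have mp: "(\<lambda>i. m (p i)) \<in> Gamma_cone (Suc k) UNIV"
        using B(2) by (auto simp: Gamma_cone_elsym esym_eq_elsym)
      have "real (Suc k) * elsym (Suc k) UNIV l \<le> (\<Sum>i\<in>UNIV. m (p i) * g i)"
        unfolding g_def using esm B(3) es by (intro garding_vector l mp) (auto simp: sigma_def)
      also have "\<dots> \<le> (\<Sum>i\<in>UNIV. g i * hermitian_form B (x i))"
        using p(2) unfolding BV form W_def[symmetric] by (simp add: sum_distrib_left mult_ac)
      finally show "(\<Sum>i\<in>UNIV. g i * hermitian_form A (x i)) \<le> (\<Sum>i\<in>UNIV. g i * hermitian_form B (x i))"
        by (simp only: gA)
    qed
  qed (use gpos in blast)
qed

lemma sigma_1_eq_trace:
  fixes A :: "complex ^ 'n::finite ^ 'n"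
  assumes "hermitian A"
  shows "esym 1 UNIV (eigenvalues A) = Re (\<Sum>i\<in>UNIV. A $ i $ i)"
proof -
  obtain U l where U: "unitary U" and AU: "A = U ** real_diag l ** adjoint_matrix U"
    using spectral_theorem[OF assms] .
  have "(\<Sum>i\<in>UNIV. A $ i $ i) = (\<Sum>i\<in>UNIV. \<Sum>a\<in>UNIV. of_real (l a * (cmod (U $ i $ a))\<^sup>2))"
    unfolding AU spectral_entry by (simp only: of_real_mult complex_norm_square mult_ac)
  also have "\<dots> = (\<Sum>a\<in>UNIV. of_real (l a * (\<Sum>i\<in>UNIV. (cmod (U $ i $ a))\<^sup>2)))"
    unfolding sum_distrib_left of_real_sum by (rule sum.swap)
  also have "\<dots> = of_real (\<Sum>a\<in>UNIV. l a)" by (simp only: unitary_row_sum(2)[OF U] of_real_sum mult_1_right)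
  finally have "Re (\<Sum>i\<in>UNIV. A $ i $ i) = (\<Sum>a\<in>UNIV. l a)" by (simp only: Re_complex_of_real)
  then show ?thesis by (simp only: esym_eigenvalues[OF U AU] elsym_1[OF finite] One_nat_def)
qed

section \<open>Second derivatives and the complex Hessian\<close>

text \<open>The vector that represents the linear form \<open>w \<mapsto> D\<^sup>2 f(x)(v, w)\<close>.\<close>
definition hessian_op :: "('a::euclidean_space \<Rightarrow> real) \<Rightarrow> 'a \<Rightarrow> 'a \<Rightarrow> 'a" where
  "hessian_op f x v = (\<Sum>c\<in>Basis. (\<Sum>b\<in>Basis. inner v b * iter_deriv [b, c] f x) *\<^sub>R c)"

lemma has_real_derivative_along_curve:
  assumes "(f has_derivative F) (at (c t))" "(c has_vector_derivative v) (at t)"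
  shows "((\<lambda>t. f (c t)) has_real_derivative F v) (at t)"
proof -
  have "((\<lambda>t. f (c t)) has_derivative (\<lambda>h. F (h *\<^sub>R v))) (at t)"
    using has_derivative_compose[OF assms(2)[unfolded has_vector_derivative_def] assms(1)] by simp
  moreover have "F (h *\<^sub>R v) = F v * h" for h
    using linear_scale[OF has_derivative_linear[OF assms(1)]] by simp
  ultimately show ?thesis by (simp add: has_field_derivative_def mult_commute_abs)
qed

lemma has_vector_derivative_line: "((\<lambda>t. x + t *\<^sub>R v) has_vector_derivative v) (at t)"
  by (auto intro!: derivative_eq_intros)

context
  fixes u :: "'a::euclidean_space \<Rightarrow> real" and S
  assumes S: "open S" and u: "C_on 2 u S"
begin

lemma C2_differentiable:
  assumes "x \<in> S"
  shows "u differentiable (at x)" "b \<in> Basis \<Longrightarrow> dir_deriv b u differentiable (at x)"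
proof -
  have "iter_deriv [] u differentiable_on S"
    using u unfolding C_on_def by (metis list.size(3) list.set(1) empty_subsetI zero_less_numeral zero_le_numeral)
  then show "u differentiable (at x)"
    using assms S by (simp add: differentiable_on_eq_differentiable_at)
  assume "b \<in> Basis"
  then have "set [b] \<subseteq> Basis \<and> length [b] \<le> 2 \<and> length [b] < 2" by simp
  then have "iter_deriv [b] u differentiable_on S"
    using u unfolding C_on_def by blast
  then show "dir_deriv b u differentiable (at x)"
    using assms S by (simp add: differentiable_on_eq_differentiable_at)
qed

lemma C2_continuous:
  shows "continuous_on S u" "b \<in> Basis \<Longrightarrow> continuous_on S (dir_deriv b u)"
    "b \<in> Basis \<Longrightarrow> c \<in> Basis \<Longrightarrow> continuous_on S (iter_deriv [b, c] u)"
proof -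
  have C: "set bs \<subseteq> Basis \<Longrightarrow> length bs \<le> 2 \<Longrightarrow> continuous_on S (iter_deriv bs u)" for bs
    using u unfolding C_on_def by blast
  show "continuous_on S u" using C[of "[]"] by simp
  show "b \<in> Basis \<Longrightarrow> continuous_on S (dir_deriv b u)" using C[of "[b]"] by simp
  show "b \<in> Basis \<Longrightarrow> c \<in> Basis \<Longrightarrow> continuous_on S (iter_deriv [b, c] u)" using C[of "[b, c]"] by simp
qed

lemma has_derivative_gradient:
  assumes x: "x \<in> S"
  shows "(u has_derivative (\<lambda>v. inner (gradient u x) v)) (at x)"
proof -
  have D: "(u has_derivative frechet_derivative u (at x)) (at x)"
    using C2_differentiable(1)[OF x] frechet_derivative_works by blast
  have "frechet_derivative u (at x) v = inner (gradient u x) v" for v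
  proof -
    have "frechet_derivative u (at x) v = frechet_derivative u (at x) (\<Sum>b\<in>Basis. inner v b *\<^sub>R b)"
      by (simp add: euclidean_representation)
    also have "\<dots> = (\<Sum>b\<in>Basis. inner v b * dir_deriv b u x)"
      using has_derivative_linear[OF D] by (simp add: linear_sum linear_scale dir_deriv_def)
    also have "\<dots> = inner (gradient u x) v"
      by (simp add: gradient_def inner_sum_left inner_commute[of v] mult.commute)
    finally show ?thesis .
  qed
  then have "frechet_derivative u (at x) = (\<lambda>v. inner (gradient u x) v)" by (rule ext)
  with D show ?thesis by (simp only:)
qed

lemma gradient_has_derivative:
  assumes x: "x \<in> S"
  shows "(gradient u has_derivative hessian_op u x) (at x)"
proof -
  have D: "(dir_deriv c u has_derivative (\<lambda>v. \<Sum>b\<in>Basis. inner v b * iter_deriv [b, c] u x)) (at x)" if c: "c \<in> Basis" for c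
  proof -
    have D: "(dir_deriv c u has_derivative frechet_derivative (dir_deriv c u) (at x)) (at x)"
      using C2_differentiable(2)[OF x c] frechet_derivative_works by blast
    have "frechet_derivative (dir_deriv c u) (at x) v = (\<Sum>b\<in>Basis. inner v b * iter_deriv [b, c] u x)" for v
    proof -
      have "frechet_derivative (dir_deriv c u) (at x) v = frechet_derivative (dir_deriv c u) (at x) (\<Sum>b\<in>Basis. inner v b *\<^sub>R b)"
        by (simp add: euclidean_representation)
      also have "\<dots> = (\<Sum>b\<in>Basis. inner v b * iter_deriv [b, c] u x)"
        using has_derivative_linear[OF D] by (simp add: linear_sum linear_scale) (simp add: dir_deriv_def)
      finally show ?thesis .
    qed
    then have "frechet_derivative (dir_deriv c u) (at x) = (\<lambda>v. \<Sum>b\<in>Basis. inner v b * iter_deriv [b, c] u x)"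
      by (rule ext)
    with D show ?thesis by (simp only:)
  qed
  show ?thesis
    unfolding gradient_def[abs_def] hessian_op_def[abs_def]
    by (intro has_derivative_sum has_derivative_scaleR_left D)
qed

lemma continuous_on_gradient: "continuous_on S (gradient u)"
  unfolding gradient_def[abs_def] by (intro continuous_intros C2_continuous)

lemma continuous_on_hessian_op:
  assumes "continuous_on T f" "f ` T \<subseteq> S" "continuous_on T g"
  shows "continuous_on T (\<lambda>t. hessian_op u (f t) (g t))"
  unfolding hessian_op_def
  using continuous_on_compose2[OF C2_continuous(3) assms(1,2)] assms(3)
  by (intro continuous_intros) auto

lemma DERIV_line:
  assumes "x + s *\<^sub>R v \<in> S"
  shows "((\<lambda>s. u (x + s *\<^sub>R v)) has_real_derivative inner (gradient u (x + s *\<^sub>R v)) v) (at s)"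
    and "((\<lambda>s. inner (gradient u (x + s *\<^sub>R v)) w) has_real_derivative inner (hessian_op u (x + s *\<^sub>R v) v) w) (at s)"
proof -
  show "((\<lambda>s. u (x + s *\<^sub>R v)) has_real_derivative inner (gradient u (x + s *\<^sub>R v)) v) (at s)"
    by (rule has_real_derivative_along_curve[OF has_derivative_gradient[OF assms] has_vector_derivative_line])
  have "((\<lambda>y. inner (gradient u y) w) has_derivative (\<lambda>v'. inner (hessian_op u (x + s *\<^sub>R v) v') w)) (at (x + s *\<^sub>R v))"
    by (intro has_derivative_inner_left gradient_has_derivative assms)
  from has_real_derivative_along_curve[OF this has_vector_derivative_line]
  show "((\<lambda>s. inner (gradient u (x + s *\<^sub>R v)) w) has_real_derivative inner (hessian_op u (x + s *\<^sub>R v) v) w) (at s)" .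
qed

text \<open>The left-hand side of the equation is symmetric in \<open>v\<close> and \<open>w\<close>, the right-hand side differentiates
first in the direction \<open>v\<close>; letting \<open>h\<close> tend to 0 shows that second derivatives commute.\<close>
lemma second_difference_mean_value:
  assumes h: "h > 0" and sub: "\<And>s t. 0 \<le> s \<Longrightarrow> s \<le> h \<Longrightarrow> 0 \<le> t \<Longrightarrow> t \<le> h \<Longrightarrow> x + s *\<^sub>R v + t *\<^sub>R w \<in> S"
  obtains s t where "0 < s" "s < h" "0 < t" "t < h"
    "u (x + h *\<^sub>R v + h *\<^sub>R w) - u (x + h *\<^sub>R v) - u (x + h *\<^sub>R w) + u x
      = h\<^sup>2 * inner (hessian_op u (x + s *\<^sub>R v + t *\<^sub>R w) w) v"
proof -
  define f where "f s = u ((x + h *\<^sub>R w) + s *\<^sub>R v) - u (x + s *\<^sub>R v)" for s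
  have sub1: "x + h *\<^sub>R w + s *\<^sub>R v \<in> S" "x + s *\<^sub>R v \<in> S" if "0 \<le> s" "s \<le> h" for s
    using sub[of s h] sub[of s 0] that h by (simp_all add: add_ac)
  have "\<exists>s>0. s < h \<and> f h - f 0 = (h - 0) * (inner (gradient u (x + h *\<^sub>R w + s *\<^sub>R v)) v - inner (gradient u (x + s *\<^sub>R v)) v)"
    unfolding f_def using h by (intro MVT2 DERIV_diff DERIV_line sub1) auto
  then obtain s where s: "0 < s" "s < h"
    and 1: "f h - f 0 = h * (inner (gradient u (x + h *\<^sub>R w + s *\<^sub>R v)) v - inner (gradient u (x + s *\<^sub>R v)) v)" by auto
  have "\<exists>t>0. t < h \<and> inner (gradient u (x + s *\<^sub>R v + h *\<^sub>R w)) v - inner (gradient u (x + s *\<^sub>R v + 0 *\<^sub>R w)) v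
      = (h - 0) * inner (hessian_op u (x + s *\<^sub>R v + t *\<^sub>R w) w) v"
    using h s sub by (intro MVT2 DERIV_line) auto
  then obtain t where t: "0 < t" "t < h" and 2: "inner (gradient u (x + s *\<^sub>R v + h *\<^sub>R w)) v - inner (gradient u (x + s *\<^sub>R v)) v
      = h * inner (hessian_op u (x + s *\<^sub>R v + t *\<^sub>R w) w) v" by auto
  have "x + h *\<^sub>R w + s *\<^sub>R v = x + s *\<^sub>R v + h *\<^sub>R w" by simp
  then have "f h - f 0 = h\<^sup>2 * inner (hessian_op u (x + s *\<^sub>R v + t *\<^sub>R w) w) v"
    using 1 2 by (simp only: power2_eq_square mult.assoc)
  moreover have "f h - f 0 = u (x + h *\<^sub>R v + h *\<^sub>R w) - u (x + h *\<^sub>R v) - u (x + h *\<^sub>R w) + u x"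
    by (simp add: f_def add_ac)
  ultimately show thesis using that s t by metis
qed

lemma hessian_op_symmetric:
  assumes x: "x \<in> S"
  shows "inner (hessian_op u x v) w = inner (hessian_op u x w) v"
proof (rule ccontr)
  assume ne: "inner (hessian_op u x v) w \<noteq> inner (hessian_op u x w) v"
  define d where "d = \<bar>inner (hessian_op u x v) w - inner (hessian_op u x w) v\<bar> / 2"
  have d: "d > 0" using ne by (simp add: d_def)
  have "continuous_on S (\<lambda>y. inner (hessian_op u y a) b)" for a b
    by (intro continuous_intros continuous_on_hessian_op) auto
  then have near: "\<exists>r>0. \<forall>y. dist y x < r \<longrightarrow> \<bar>inner (hessian_op u y a) b - inner (hessian_op u x a) b\<bar> < d" for a b
    using x S d by (simp add: continuous_on_eq_continuous_at continuous_at dist_real_def Lim_at) (metis dist_self diff_self abs_zero dist_nz)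
  obtain r0 where r0: "r0 > 0" "ball x r0 \<subseteq> S" using S x openE by blast
  obtain r1 where r1: "r1 > 0" "\<And>y. dist y x < r1 \<Longrightarrow> \<bar>inner (hessian_op u y v) w - inner (hessian_op u x v) w\<bar> < d"
    using near by blast
  obtain r2 where r2: "r2 > 0" "\<And>y. dist y x < r2 \<Longrightarrow> \<bar>inner (hessian_op u y w) v - inner (hessian_op u x w) v\<bar> < d"
    using near by blast
  define r where "r = min r0 (min r1 r2)"
  define N where "N = norm v + norm w + 1"
  have N: "N > 0" by (simp add: N_def add_nonneg_pos)
  define h where "h = r / (2 * N)"
  have r: "r > 0" using r0 r1 r2 by (simp add: r_def)
  have h: "h > 0" using r N by (simp add: h_def)
  have dist: "dist (x + s *\<^sub>R v + t *\<^sub>R w) x < r" if "0 \<le> s" "s \<le> h" "0 \<le> t" "t \<le> h" for s t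
  proof -
    have "dist (x + s *\<^sub>R v + t *\<^sub>R w) x = norm (s *\<^sub>R v + t *\<^sub>R w)" by (simp add: dist_norm add.assoc)
    also have "\<dots> \<le> s * norm v + t * norm w"
      using that norm_triangle_ineq[of "s *\<^sub>R v" "t *\<^sub>R w"] by simp
    also have "\<dots> \<le> h * norm v + h * norm w" using that by (intro add_mono mult_right_mono) auto
    also have "\<dots> \<le> h * N" using h by (simp add: N_def algebra_simps)
    also have "\<dots> = r / 2" using N by (simp add: h_def)
    also have "\<dots> < r" using r by simp
    finally show ?thesis .
  qed
  have inS: "x + s *\<^sub>R v + t *\<^sub>R w \<in> S" if "0 \<le> s" "s \<le> h" "0 \<le> t" "t \<le> h" for s t
    using dist[OF that] r0(2) by (auto simp: r_def dist_commute subset_iff)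
  have inS': "x + t *\<^sub>R w + s *\<^sub>R v \<in> S" if "0 \<le> t" "t \<le> h" "0 \<le> s" "s \<le> h" for s t
    using inS[of s t] that by (simp add: add_ac)
  obtain s t where st: "0 < s" "s < h" "0 < t" "t < h"
    "u (x + h *\<^sub>R v + h *\<^sub>R w) - u (x + h *\<^sub>R v) - u (x + h *\<^sub>R w) + u x
      = h\<^sup>2 * inner (hessian_op u (x + s *\<^sub>R v + t *\<^sub>R w) w) v"
    using second_difference_mean_value[OF h inS] by blast
  obtain s' t' where st': "0 < s'" "s' < h" "0 < t'" "t' < h"
    "u (x + h *\<^sub>R w + h *\<^sub>R v) - u (x + h *\<^sub>R w) - u (x + h *\<^sub>R v) + u x
      = h\<^sup>2 * inner (hessian_op u (x + s' *\<^sub>R w + t' *\<^sub>R v) v) w"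
    using second_difference_mean_value[OF h inS'] by blast
  have swap: "x + h *\<^sub>R w + h *\<^sub>R v = x + h *\<^sub>R v + h *\<^sub>R w" by simp
  have "h\<^sup>2 * inner (hessian_op u (x + s *\<^sub>R v + t *\<^sub>R w) w) v = h\<^sup>2 * inner (hessian_op u (x + s' *\<^sub>R w + t' *\<^sub>R v) v) w"
    using st(5) st'(5)[unfolded swap] by linarith
  then have eq: "inner (hessian_op u (x + s *\<^sub>R v + t *\<^sub>R w) w) v = inner (hessian_op u (x + s' *\<^sub>R w + t' *\<^sub>R v) v) w"
    using h by simp
  have "\<bar>inner (hessian_op u (x + s *\<^sub>R v + t *\<^sub>R w) w) v - inner (hessian_op u x w) v\<bar> < d"
    using dist[of s t] st by (intro r2(2)) (auto simp: r_def)
  moreover have "\<bar>inner (hessian_op u (x + s' *\<^sub>R w + t' *\<^sub>R v) v) w - inner (hessian_op u x v) w\<bar> < d"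
    using dist[of t' s'] st' by (intro r1(2)) (auto simp: r_def add_ac)
  moreover have "\<bar>X - Q\<bar> < \<bar>P - Q\<bar> / 2 \<Longrightarrow> \<bar>X - P\<bar> < \<bar>P - Q\<bar> / 2 \<Longrightarrow> False" for X P Q :: real
    by (auto simp: abs_if split: if_splits)
  ultimately show False unfolding eq d_def by blast
qed

end

lemma hessian_op_add: "hessian_op f x (v + w) = hessian_op f x v + hessian_op f x w"
  by (simp add: hessian_op_def inner_add_left ring_distribs sum.distrib scaleR_add_left)

lemma hessian_op_scaleR: "hessian_op f x (r *\<^sub>R v) = r *\<^sub>R hessian_op f x v"
  by (simp add: hessian_op_def scaleR_sum_right sum_distrib_left mult.assoc)

lemma linear_hessian_op: "linear (hessian_op f x)"
  by (rule linearI) (simp_all add: hessian_op_add hessian_op_scaleR)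

lemma power2_norm_eq_sum_components: "(norm v)\<^sup>2 = (\<Sum>b\<in>Basis. (inner v b)\<^sup>2)"
  by (subst power2_norm_eq_inner, subst euclidean_inner) (simp only: power2_eq_square)

lemma norm_hessian_op: "norm (hessian_op f x v) \<le> sqrt (\<Sum>b\<in>Basis. \<Sum>c\<in>Basis. (iter_deriv [b, c] f x)\<^sup>2) * norm v"
proof -
  have comp: "inner (hessian_op f x v) c = (\<Sum>b\<in>Basis. inner v b * iter_deriv [b, c] f x)" if "c \<in> Basis" for c
    using that by (simp add: hessian_op_def inner_sum_left inner_Basis if_distrib sum.delta cong: if_cong)
  have "(norm (hessian_op f x v))\<^sup>2 = (\<Sum>c\<in>Basis. (inner (hessian_op f x v) c)\<^sup>2)"
    by (rule power2_norm_eq_sum_components)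
  also have "\<dots> \<le> (\<Sum>c\<in>Basis. (\<Sum>b\<in>Basis. (inner v b)\<^sup>2) * (\<Sum>b\<in>Basis. (iter_deriv [b, c] f x)\<^sup>2))"
    using comp by (intro sum_mono) (simp add: Cauchy_Schwarz_ineq_sum)
  also have "\<dots> = (norm v)\<^sup>2 * (\<Sum>c\<in>Basis. \<Sum>b\<in>Basis. (iter_deriv [b, c] f x)\<^sup>2)"
    by (simp only: sum_distrib_left power2_norm_eq_sum_components[of v])
  also have "(\<Sum>c\<in>Basis. \<Sum>b\<in>Basis. (iter_deriv [b, c] f x)\<^sup>2) = (\<Sum>b\<in>Basis. \<Sum>c\<in>Basis. (iter_deriv [b, c] f x)\<^sup>2)"
    by (rule sum.swap)
  finally have "sqrt ((norm (hessian_op f x v))\<^sup>2) \<le> sqrt ((norm v)\<^sup>2 * (\<Sum>b\<in>Basis. \<Sum>c\<in>Basis. (iter_deriv [b, c] f x)\<^sup>2))"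
    by (rule real_sqrt_le_mono)
  then show ?thesis by (simp add: real_sqrt_mult mult.commute)
qed

lemma iter_deriv_eq_hessian_op:
  "b \<in> Basis \<Longrightarrow> c \<in> Basis \<Longrightarrow> iter_deriv [b, c] f x = inner (hessian_op f x b) c"
  by (simp add: hessian_op_def inner_sum_left inner_Basis if_distrib if_distribR sum.delta sum.delta' cong: if_cong)

lemma complex_hessian_entry:
  fixes u :: "complex ^ 'n::finite \<Rightarrow> real"
  assumes S: "open S" and u: "C_on 2 u S" and z: "z \<in> S"
  shows "complex_hessian u z $ i $ j = 
    (complex_of_real (inner (hessian_op u z (axis i 1)) (axis j 1) + inner (hessian_op u z (axis i \<i>)) (axis j \<i>))
     + \<i> * complex_of_real (inner (hessian_op u z (axis i 1)) (axis j \<i>) - inner (hessian_op u z (axis i \<i>)) (axis j 1))) / 4"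
proof -
  define U where "U w = complex_of_real (u w)" for w
  have dU: "dir_deriv v U y = complex_of_real (inner (gradient u y) v)" if "y \<in> S" for v y
  proof -
    have "(U has_derivative (\<lambda>v. complex_of_real (inner (gradient u y) v))) (at y)"
      unfolding U_def[abs_def] by (intro has_derivative_of_real has_derivative_gradient[OF S u that])
    then show ?thesis unfolding dir_deriv_def by (simp only: frechet_derivative_at[symmetric])
  qed
  let ?W = "\<lambda>y. (complex_of_real (inner (gradient u y) (axis j 1)) + \<i> * complex_of_real (inner (gradient u y) (axis j \<i>))) / 2"
  have W: "wirtinger_bar j U y = ?W y" if "y \<in> S" for y
    by (simp add: wirtinger_bar_def dU[OF that])
  have "(?W has_derivative (\<lambda>v. (complex_of_real (inner (hessian_op u z v) (axis j 1)) + \<i> * complex_of_real (inner (hessian_op u z v) (axis j \<i>))) / 2)) (at z)"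
    unfolding divide_inverse by (intro has_derivative_mult_left has_derivative_add has_derivative_mult_right has_derivative_of_real
        has_derivative_inner_left gradient_has_derivative[OF S u z])
  then have "(wirtinger_bar j U has_derivative (\<lambda>v. (complex_of_real (inner (hessian_op u z v) (axis j 1)) + \<i> * complex_of_real (inner (hessian_op u z v) (axis j \<i>))) / 2)) (at z)"
    by (rule has_derivative_transform_within_open[OF _ S z]) (simp add: W)
  then have dW: "dir_deriv v (wirtinger_bar j U) z = (complex_of_real (inner (hessian_op u z v) (axis j 1)) + \<i> * complex_of_real (inner (hessian_op u z v) (axis j \<i>))) / 2" for v
    unfolding dir_deriv_def by (simp only: frechet_derivative_at[symmetric])
  show ?thesis
    unfolding complex_hessian_def U_def[symmetric] vec_lambda_beta wirtinger_def[of i] dW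
    by (simp add: field_simps complex_eq_iff)
qed

lemma hermitian_complex_hessian:
  assumes "open S" "C_on 2 u S" "z \<in> S"
  shows "hermitian (complex_hessian u z)"
  unfolding hermitian_def adjoint_matrix_def vec_eq_iff
  using hessian_op_symmetric[OF assms]
  by (simp add: complex_hessian_entry[OF assms] complex_eq_iff)

text \<open>The entries of the complex Hessian are the values on the standard basis of the form
\<open>K v w = D\<^sup>2u(v, w) + D\<^sup>2u(\<i>v, \<i>w) + \<i> (D\<^sup>2u(v, \<i>w) - D\<^sup>2u(\<i>v, w))\<close>, up to the factor 4. This form is
complex linear in \<open>v\<close> and conjugate linear in \<open>w\<close>, so its values on the diagonal can be read off from
those entries.\<close>
lemma hermitian_form_complex_hessian:
  fixes u :: "complex ^ 'n::finite \<Rightarrow> real"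
  assumes "open S" "C_on 2 u S" "z \<in> S"
  shows "4 * hermitian_form (complex_hessian u z) x
    = inner (hessian_op u z x) x + inner (hessian_op u z (\<i> *s x)) (\<i> *s x)"
proof -
  define h where "h v w = inner (hessian_op u z v) w" for v w
  have h: "h (v + v') w = h v w + h v' w" "h v (w + w') = h v w + h v w'"
    "h (r *\<^sub>R v) w = r * h v w" "h v (r *\<^sub>R w) = r * h v w" "h (- v) w = - h v w" "h v (- w) = - h v w" for v v' w w' r
    using linear_neg[OF linear_hessian_op, of u z v]
    by (simp_all add: h_def hessian_op_add hessian_op_scaleR inner_add_left inner_add_right)
  define K where "K v w = complex_of_real (h v w + h (\<i> *s v) (\<i> *s w)) + \<i> * complex_of_real (h v (\<i> *s w) - h (\<i> *s v) w)" for v w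
  have smult: "c *s v = Re c *\<^sub>R v + Im c *\<^sub>R (\<i> *s v)" for c and v :: "complex ^ 'n"
    unfolding vec_eq_iff by (simp add: complex_eq_iff)
  have i_smult: "\<i> *s (c *s v) = Re c *\<^sub>R (\<i> *s v) + (- Im c) *\<^sub>R v" for c and v :: "complex ^ 'n"
    unfolding vec_eq_iff by (simp add: complex_eq_iff)
  have K_left: "K (c *s v) w = c * K v w" for c v w
    unfolding K_def i_smult unfolding smult[of c] h by (simp add: complex_eq_iff algebra_simps)
  have K_right: "K v (c *s w) = cnj c * K v w" for c v w
    unfolding K_def i_smult unfolding smult[of c] h by (simp add: complex_eq_iff algebra_simps)
  have i_add: "\<i> *s (v + w) = \<i> *s v + \<i> *s w" for v w :: "complex ^ 'n" by (simp add: vec_eq_iff algebra_simps)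
  have K_add: "K (v + v') w = K v w + K v' w" "K v (w + w') = K v w + K v w'" for v v' w w'
    unfolding K_def i_add h by (simp_all add: complex_eq_iff algebra_simps)
  have K0: "K 0 w = 0" "K v 0 = 0" for v w using K_left[of 0 0 w] K_right[of v 0 0] by simp_all
  have K_sum: "K (sum f I) w = (\<Sum>i\<in>I. K (f i) w)" "K v (sum f I) = (\<Sum>i\<in>I. K v (f i))" if "finite I" for f v w and I :: "'n set"
    using that by (induction I rule: finite_induct) (simp_all add: K0 K_add)
  have ia: "\<i> *s axis i 1 = (axis i \<i> :: complex ^ 'n)" for i by (simp add: vec_eq_iff axis_def)
  have entry: "4 * complex_hessian u z $ i $ j = K (axis i 1) (axis j 1)" for i j
    unfolding complex_hessian_entry[OF assms] K_def ia h_def by simp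
  have "K x x = K (\<Sum>i\<in>UNIV. x $ i *s axis i 1) (\<Sum>j\<in>UNIV. x $ j *s axis j 1)" by (simp add: basis_expansion)
  also have "\<dots> = (\<Sum>i\<in>UNIV. \<Sum>j\<in>UNIV. 4 * (complex_hessian u z $ i $ j * x $ i * cnj (x $ j)))"
    by (simp only: K_sum(1)[OF finite], simp only: K_sum(2)[OF finite])
      (simp add: K_left K_right entry[symmetric] mult_ac)
  also have "\<dots> = 4 * (\<Sum>i\<in>UNIV. \<Sum>j\<in>UNIV. complex_hessian u z $ i $ j * x $ i * cnj (x $ j))"
    by (simp add: sum_distrib_left)
  finally have "Re (K x x) = 4 * hermitian_form (complex_hessian u z) x"
    by (simp add: hermitian_form_def)
  then show ?thesis by (simp add: K_def h_def)
qed

lemma trace_complex_hessian: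
  fixes u :: "complex ^ 'n::finite \<Rightarrow> real"
  assumes "open S" "C_on 2 u S" "z \<in> S"
  shows "4 * Re (\<Sum>i\<in>UNIV. complex_hessian u z $ i $ i) = (\<Sum>b\<in>Basis. inner (hessian_op u z b) b)"
proof -
  have "(\<Sum>b\<in>Basis. inner (hessian_op u z b) b) = (\<Sum>i\<in>UNIV. \<Sum>c\<in>Basis. inner (hessian_op u z (axis i c)) (axis i c))"
    unfolding Basis_vec_def
    by (subst sum.UNION_disjoint) (auto simp: axis_eq_axis sum.UNION_disjoint)
  also have "\<dots> = (\<Sum>i\<in>UNIV. 4 * Re (complex_hessian u z $ i $ i))"
    by (simp add: complex_hessian_entry[OF assms] Basis_complex_def add_divide_distrib)
  finally show ?thesis by (simp add: sum_distrib_left)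
qed

text \<open>A linear change of variables \<open>y \<mapsto> V y\<close> acts on complex Hessians by congruence with the transpose of
\<open>V\<close>.\<close>
lemma hermitian_form_congruence:
  "hermitian_form (Y ** H ** adjoint_matrix Y) x = hermitian_form H (transpose Y *v x)"
proof -
  have tx: "(transpose Y *v x) $ a = (\<Sum>i\<in>UNIV. Y $ i $ a * x $ i)" for a
    by (simp add: transpose_def matrix_vector_mult_def)
  have "(\<Sum>i\<in>UNIV. \<Sum>j\<in>UNIV. (Y ** H ** adjoint_matrix Y) $ i $ j * x $ i * cnj (x $ j))
    = (\<Sum>i\<in>UNIV. \<Sum>j\<in>UNIV. \<Sum>b\<in>UNIV. \<Sum>a\<in>UNIV. H $ a $ b * (Y $ i $ a * x $ i) * cnj (Y $ j $ b * x $ j))"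
    by (simp add: matrix_matrix_mult_def adjoint_matrix_def sum_distrib_left sum_distrib_right mult_ac)
  also have "\<dots> = (\<Sum>i\<in>UNIV. \<Sum>b\<in>UNIV. \<Sum>j\<in>UNIV. \<Sum>a\<in>UNIV. H $ a $ b * (Y $ i $ a * x $ i) * cnj (Y $ j $ b * x $ j))"
    by (intro sum.cong refl sum.swap)
  also have "\<dots> = (\<Sum>i\<in>UNIV. \<Sum>b\<in>UNIV. \<Sum>a\<in>UNIV. \<Sum>j\<in>UNIV. H $ a $ b * (Y $ i $ a * x $ i) * cnj (Y $ j $ b * x $ j))"
    by (intro sum.cong refl sum.swap)
  also have "\<dots> = (\<Sum>i\<in>UNIV. \<Sum>a\<in>UNIV. \<Sum>b\<in>UNIV. \<Sum>j\<in>UNIV. H $ a $ b * (Y $ i $ a * x $ i) * cnj (Y $ j $ b * x $ j))"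
    by (intro sum.cong refl sum.swap)
  also have "\<dots> = (\<Sum>a\<in>UNIV. \<Sum>i\<in>UNIV. \<Sum>b\<in>UNIV. \<Sum>j\<in>UNIV. H $ a $ b * (Y $ i $ a * x $ i) * cnj (Y $ j $ b * x $ j))"
    by (rule sum.swap)
  also have "\<dots> = (\<Sum>a\<in>UNIV. \<Sum>b\<in>UNIV. \<Sum>i\<in>UNIV. \<Sum>j\<in>UNIV. H $ a $ b * (Y $ i $ a * x $ i) * cnj (Y $ j $ b * x $ j))"
    by (intro sum.cong refl sum.swap)
  also have "\<dots> = (\<Sum>a\<in>UNIV. \<Sum>b\<in>UNIV. H $ a $ b * (transpose Y *v x) $ a * cnj ((transpose Y *v x) $ b))"
    by (simp only: tx cnj_sum mult.assoc, simp only: sum_product, simp only: sum_distrib_left mult.assoc complex_cnj_mult)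
  finally show ?thesis by (simp add: hermitian_form_def)
qed

section \<open>One-parameter groups of unitary maps and dilations\<close>

definition complex_diag :: "('n \<Rightarrow> complex) \<Rightarrow> complex ^ 'n ^ 'n" where
  "complex_diag d = (\<chi> i j. if i = j then d i else 0)"

text \<open>The normal matrix with the eigenvalues \<open>d\<close> and the columns of \<open>U\<close> as eigenvectors. Exponentials of
such matrices are obtained by applying \<open>exp\<close> to \<open>d\<close>.\<close>
definition spectral_matrix :: "complex ^ 'n ^ 'n \<Rightarrow> ('n \<Rightarrow> complex) \<Rightarrow> complex ^ 'n::finite ^ 'n" where
  "spectral_matrix U d = U ** complex_diag d ** adjoint_matrix U"

lemma spectral_matrix_real_diag:
  "U ** real_diag l ** adjoint_matrix U = spectral_matrix U (\<lambda>i. complex_of_real (l i))"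
  by (simp add: spectral_matrix_def complex_diag_def real_diag_def)

lemma complex_diag_mult: "complex_diag d ** complex_diag e = complex_diag (\<lambda>i. d i * e i)"
  by (simp add: complex_diag_def matrix_matrix_mult_def vec_eq_iff mult_delta_left mult_delta_right)

lemma complex_diag_1: "complex_diag (\<lambda>i. 1) = mat 1"
  unfolding complex_diag_def mat_def by (rule refl)

lemma spectral_matrix_mult:
  assumes "unitary U"
  shows "spectral_matrix U d ** spectral_matrix U e = spectral_matrix U (\<lambda>i. d i * e i)"
proof -
  have "spectral_matrix U d ** spectral_matrix U e
      = U ** complex_diag d ** (adjoint_matrix U ** U) ** complex_diag e ** adjoint_matrix U"
    by (simp add: spectral_matrix_def matrix_mul_assoc)
  also have "\<dots> = U ** (complex_diag d ** complex_diag e) ** adjoint_matrix U"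
    using assms by (simp add: unitary_def matrix_mul_assoc)
  finally show ?thesis by (simp add: complex_diag_mult spectral_matrix_def)
qed

lemma spectral_matrix_1: "unitary U \<Longrightarrow> spectral_matrix U (\<lambda>i. 1) = mat 1"
  by (simp add: spectral_matrix_def complex_diag_1 unitary_right)

lemma adjoint_spectral_matrix: "adjoint_matrix (spectral_matrix U d) = spectral_matrix U (\<lambda>i. cnj (d i))"
proof -
  have "adjoint_matrix (complex_diag d) = complex_diag (\<lambda>i. cnj (d i))"
    by (simp add: adjoint_matrix_def complex_diag_def vec_eq_iff)
  then show ?thesis
    by (simp add: spectral_matrix_def adjoint_matrix_mult adjoint_matrix_adjoint matrix_mul_assoc)
qed

text \<open>For unitary \<open>U\<close>, the orthogonal projection of \<open>y\<close> to the line spanned by the column \<open>a\<close> of \<open>U\<close>.\<close>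
definition spectral_component :: "complex ^ 'n ^ 'n::finite \<Rightarrow> complex ^ 'n \<Rightarrow> 'n \<Rightarrow> complex ^ 'n" where
  "spectral_component U y a = (\<chi> i. U $ i $ a * (\<Sum>j\<in>UNIV. cnj (U $ j $ a) * y $ j))"

lemma spectral_matrix_vector:
  "spectral_matrix U d *v y = (\<Sum>a\<in>UNIV. d a *s spectral_component U y a)"
proof -
  have entry: "spectral_matrix U d $ i $ j = (\<Sum>a\<in>UNIV. U $ i $ a * d a * cnj (U $ j $ a))" for i j
    by (simp add: spectral_matrix_def complex_diag_def matrix_matrix_mult_def adjoint_matrix_def mult_delta_left mult_delta_right)
  have "(spectral_matrix U d *v y) $ i = (\<Sum>a\<in>UNIV. d a *s spectral_component U y a) $ i" for i
  proof -
    have "(spectral_matrix U d *v y) $ i = (\<Sum>j\<in>UNIV. \<Sum>a\<in>UNIV. d a * (U $ i $ a * (cnj (U $ j $ a) * y $ j)))"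
      by (simp add: matrix_vector_mult_def entry sum_distrib_right sum_distrib_left mult_ac)
    also have "\<dots> = (\<Sum>a\<in>UNIV. \<Sum>j\<in>UNIV. d a * (U $ i $ a * (cnj (U $ j $ a) * y $ j)))" by (rule sum.swap)
    also have "\<dots> = (\<Sum>a\<in>UNIV. d a *s spectral_component U y a) $ i"
      by (simp add: spectral_component_def sum_distrib_left)
    finally show ?thesis .
  qed
  then show ?thesis by (simp add: vec_eq_iff)
qed

lemma bounded_linear_smult_left: "bounded_linear (\<lambda>c::complex. c *s (w :: complex ^ 'n::finite))"
  unfolding linear_conv_bounded_linear[symmetric]
  by (rule linearI) (simp_all add: vec_eq_iff ring_distribs)

lemma spectral_exp_has_vector_derivative:
  assumes "unitary U"
  shows "((\<lambda>t. spectral_matrix U (\<lambda>i. exp (t *\<^sub>R d i)) *v y) has_vector_derivative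
    spectral_matrix U d *v (spectral_matrix U (\<lambda>i. exp (t *\<^sub>R d i)) *v y)) (at t)"
proof -
  have "((\<lambda>t. \<Sum>a\<in>UNIV. exp (t *\<^sub>R d a) *s spectral_component U y a) has_vector_derivative
     (\<Sum>a\<in>UNIV. (exp (t *\<^sub>R d a) * d a) *s spectral_component U y a)) (at t)"
    by (intro has_vector_derivative_sum bounded_linear.has_vector_derivative[OF bounded_linear_smult_left]
        exp_scaleR_has_vector_derivative_right)
  also have "(\<Sum>a\<in>UNIV. (exp (t *\<^sub>R d a) * d a) *s spectral_component U y a)
      = spectral_matrix U d *v (spectral_matrix U (\<lambda>i. exp (t *\<^sub>R d i)) *v y)"
    unfolding matrix_vector_mul_assoc spectral_matrix_mult[OF assms] by (simp only: spectral_matrix_vector mult.commute)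
  finally show ?thesis by (simp only: spectral_matrix_vector)
qed

lemma spectral_exp_continuous:
  "continuous_on UNIV (\<lambda>p. spectral_matrix U (\<lambda>i. exp (fst p *\<^sub>R d i)) *v snd p)"
proof -
  have "continuous_on UNIV (\<lambda>p. \<Sum>a\<in>UNIV. (\<chi> i. exp (fst p *\<^sub>R d a) * (U $ i $ a * (\<Sum>j\<in>UNIV. cnj (U $ j $ a) * snd p $ j))))"
    by (intro continuous_intros)
  also have "(\<lambda>p. \<Sum>a\<in>UNIV. (\<chi> i. exp (fst p *\<^sub>R d a) * (U $ i $ a * (\<Sum>j\<in>UNIV. cnj (U $ j $ a) * snd p $ j))))
     = (\<lambda>p. spectral_matrix U (\<lambda>i. exp (fst p *\<^sub>R d i)) *v snd p)"
    by (simp add: fun_eq_iff spectral_matrix_vector spectral_component_def vec_eq_iff)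
  finally show ?thesis .
qed

lemma scaleR_eq_smult: "r *\<^sub>R v = complex_of_real r *s (v :: complex ^ 'n)"
  unfolding vec_eq_iff vector_scaleR_component vector_smult_component by (simp add: scaleR_conv_of_real)

lemma norm_smult: "norm (c *s v) = cmod c * norm (v :: complex ^ 'n::finite)"
proof -
  have "complex_of_real ((norm (c *s v))\<^sup>2) = (c * cnj c) * cinner v v"
    unfolding cinner_self[symmetric] by (simp add: cinner_def sum_distrib_left mult_ac)
  also have "\<dots> = complex_of_real ((cmod c * norm v)\<^sup>2)"
    by (simp only: complex_norm_square[symmetric] cinner_self power_mult_distrib of_real_mult)
  finally have "(norm (c *s v))\<^sup>2 = (cmod c * norm v)\<^sup>2" by (simp only: of_real_eq_iff)
  then show ?thesis by (simp add: power2_eq_iff_nonneg)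
qed

lemma cinner_smult_left: "cinner (c *s v) w = c * cinner v w"
  by (simp add: cinner_def sum_distrib_left mult.assoc)

lemma cmod_cinner_le: "cmod (cinner v w) \<le> norm v * norm w"
proof (cases "cinner v w = 0")
  case False
  define c where "c = cnj (sgn (cinner v w))"
  have c: "cmod c = 1" using False by (simp add: c_def norm_sgn)
  have "c * cinner v w = cinner v w * cnj (cinner v w) / of_real (cmod (cinner v w))"
    by (simp add: c_def sgn_eq mult.commute)
  also have "\<dots> = of_real ((cmod (cinner v w))\<^sup>2 / cmod (cinner v w))"
    by (simp only: complex_norm_square of_real_divide)
  also have "\<dots> = of_real (cmod (cinner v w))" using False by (simp add: power2_eq_square)
  finally have "cmod (cinner v w) = inner (c *s v) w"
    by (simp add: inner_eq_Re_cinner cinner_smult_left)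
  also have "\<dots> \<le> norm (c *s v) * norm w" by (rule norm_cauchy_schwarz)
  finally show ?thesis by (simp add: norm_smult c)
qed simp

text \<open>Here \<open>exp (a t) V t\<close> is the group generated by \<open>B\<close>. Decompose \<open>\<xi> = p z + \<eta>\<close> with \<open>p\<close> complex and \<open>\<eta>\<close>
orthogonal to \<open>z\<close>. The skew-Hermitian matrix \<open>(\<eta> z\<^sup>* - z \<eta>\<^sup>*) / |z|\<^sup>2\<close> maps \<open>z\<close> to \<open>\<eta>\<close>, and
\<open>p I\<close> is the sum of a real and of a skew-Hermitian multiple of the identity; this gives \<open>B\<close>. Its
exponential exists by the spectral theorem, and its size is bounded because \<open>|p| \<le> 1\<close> and
\<open>|\<eta>| \<le> 2 |z|\<close>.\<close>
lemma conformal_flow: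
  fixes z \<xi> :: "complex ^ 'n::finite"
  assumes z: "z \<noteq> 0" and \<xi>: "norm \<xi> \<le> norm z"
  obtains a :: real and B :: "complex ^ 'n ^ 'n" and V :: "real \<Rightarrow> complex ^ 'n ^ 'n"
  where "\<bar>a\<bar> \<le> 1" "B *v z = \<xi>" "\<forall>y. norm (B *v y) \<le> 6 * norm y"
    "\<forall>t. unitary (V t)" "V 0 = mat 1"
    "\<forall>t y. ((\<lambda>t. exp (a * t) *\<^sub>R (V t *v y)) has_vector_derivative B *v (exp (a * t) *\<^sub>R (V t *v y))) (at t)"
    "continuous_on UNIV (\<lambda>p. V (fst p) *v snd p)"
proof -
  define N where "N = (norm z)\<^sup>2"
  have N: "N > 0" using z by (simp add: N_def)
  define p where "p = cinner \<xi> z / of_real N"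
  define \<eta> where "\<eta> = \<xi> - p *s z"
  define a b where "a = Re p" and "b = Im p"
  have p: "cmod p \<le> 1"
  proof -
    have "cmod (cinner \<xi> z) \<le> norm \<xi> * norm z" by (rule cmod_cinner_le)
    also have "\<dots> \<le> norm z * norm z" using \<xi> by (intro mult_right_mono) auto
    also have "\<dots> = N" by (simp add: N_def power2_eq_square)
    finally show ?thesis using N by (simp add: p_def norm_divide)
  qed
  have ab: "\<bar>a\<bar> \<le> 1" "\<bar>b\<bar> \<le> 1"
    using p abs_Re_le_cmod[of p] abs_Im_le_cmod[of p] by (auto simp: a_def b_def)
  have cdiff: "cinner (v - w) x = cinner v x - cinner w x" for v w x :: "complex ^ 'n"
    by (simp add: cinner_def left_diff_distrib sum_subtractf)
  have "cinner \<eta> z = 0" using N by (simp add: \<eta>_def cdiff cinner_smult_left cinner_self p_def N_def)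
  then have orth: "cinner z \<eta> = 0" using cinner_swap[of z \<eta>] by simp
  have \<eta>: "norm \<eta> \<le> 2 * norm z"
  proof -
    have "norm \<eta> \<le> norm \<xi> + norm (p *s z)" unfolding \<eta>_def by (rule norm_triangle_ineq4)
    also have "norm (p *s z) \<le> 1 * norm z" unfolding norm_smult using p by (intro mult_right_mono) auto
    finally show ?thesis using \<xi> by simp
  qed
  \<comment> \<open>The Hermitian matrix with \<open>B = a I + \<i> H\<close>.\<close>
  define H :: "complex ^ 'n ^ 'n" where
    "H = (\<chi> i j. (if i = j then of_real b else 0) - \<i> * (\<eta> $ i * cnj (z $ j) - z $ i * cnj (\<eta> $ j)) / of_real N)"
  have "hermitian H"
    unfolding hermitian_def adjoint_matrix_def vec_eq_iff by (auto simp: H_def algebra_simps diff_divide_distrib)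
  then obtain U l where U: "unitary U" and HU: "H = U ** real_diag l ** adjoint_matrix U"
    using spectral_theorem by blast
  define d where "d i = Complex a (l i)" for i
  define B where "B = spectral_matrix U d"
  define V where "V t = spectral_matrix U (\<lambda>i. exp (t *\<^sub>R (\<i> * of_real (l i))))" for t
  have flow: "exp (a * t) *\<^sub>R (V t *v y) = spectral_matrix U (\<lambda>i. exp (t *\<^sub>R d i)) *v y" for t y
  proof -
    have "exp (t *\<^sub>R d i) = of_real (exp (a * t)) * exp (t *\<^sub>R (\<i> * of_real (l i)))" for i
    proof -
      have "t *\<^sub>R d i = of_real (a * t) + t *\<^sub>R (\<i> * of_real (l i))" by (simp add: d_def complex_eq_iff)
      then show ?thesis by (simp only: exp_add exp_of_real)
    qed
    then show ?thesis
      by (simp only: V_def spectral_matrix_vector scaleR_eq_smult vec.scale_sum_right vector_smult_assoc)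
  qed
  have HB: "B *v y = a *\<^sub>R y + \<i> *s (H *v y)" for y
  proof -
    have d_eq: "d i = of_real a * 1 + \<i> * of_real (l i)" for i by (simp add: d_def complex_eq_iff)
    have "a *\<^sub>R y = a *\<^sub>R (spectral_matrix U (\<lambda>i. 1) *v y)" by (simp add: spectral_matrix_1[OF U])
    then show ?thesis
      unfolding HU spectral_matrix_real_diag B_def spectral_matrix_vector d_eq
      by (simp only: scaleR_eq_smult vec.scale_sum_right vector_smult_assoc sum.distrib[symmetric]
          vec.scale_left_distrib)
  qed
  have Hy: "H *v y = b *\<^sub>R y - (\<i> / of_real N) *s (cinner y z *s \<eta> - cinner y \<eta> *s z)" for y
  proof -
    have "(H *v y) $ i = of_real b * y $ i - \<i> / of_real N * (cinner y z * \<eta> $ i - cinner y \<eta> * z $ i)" for i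
    proof -
      have "(H *v y) $ i = (\<Sum>j\<in>UNIV. (if i = j then of_real b * y $ j else 0)
           - \<i> / of_real N * (y $ j * cnj (z $ j) * \<eta> $ i - y $ j * cnj (\<eta> $ j) * z $ i))"
        unfolding matrix_vector_mult_def H_def
        by (simp, intro sum.cong refl) (simp add: algebra_simps diff_divide_distrib)
      also have "\<dots> = of_real b * y $ i - \<i> / of_real N * (cinner y z * \<eta> $ i - cinner y \<eta> * z $ i)"
        by (simp add: sum_subtractf cinner_def sum_distrib_left[symmetric] sum_distrib_right del: times_divide_eq_left)
      finally show ?thesis .
    qed
    then show ?thesis unfolding vec_eq_iff vector_minus_component vector_scaleR_component vector_smult_component
      by (simp add: scaleR_conv_of_real)
  qed
  have iHy: "\<i> *s (H *v y) = b *\<^sub>R (\<i> *s y) + (1 / of_real N) *s (cinner y z *s \<eta> - cinner y \<eta> *s z)" for y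
    unfolding Hy vec_eq_iff vector_minus_component vector_add_component vector_scaleR_component vector_smult_component
    by (simp add: scaleR_conv_of_real algebra_simps)
  show thesis
  proof (rule that[of a B V])
    show "\<bar>a\<bar> \<le> 1" by (rule ab)
    have "B *v z = a *\<^sub>R z + b *\<^sub>R (\<i> *s z) + \<eta>"
      unfolding HB iHy orth using N by (simp add: cinner_self N_def[symmetric])
    also have "a *\<^sub>R z + b *\<^sub>R (\<i> *s z) = p *s z"
      by (simp add: vec_eq_iff a_def b_def complex_eq_iff)
    finally show "B *v z = \<xi>" by (simp add: \<eta>_def)
    show "\<forall>y. norm (B *v y) \<le> 6 * norm y"
    proof
      fix y :: "complex ^ 'n"
      have "norm (cinner y z *s \<eta> - cinner y \<eta> *s z) \<le> norm (cinner y z *s \<eta>) + norm (cinner y \<eta> *s z)"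
        by (rule norm_triangle_ineq4)
      also have "\<dots> \<le> (norm y * norm z) * norm \<eta> + (norm y * norm \<eta>) * norm z"
        unfolding norm_smult by (intro add_mono mult_right_mono cmod_cinner_le) auto
      also have "\<dots> = 2 * (norm y * norm z) * norm \<eta>" by simp
      also have "\<dots> \<le> 2 * (norm y * norm z) * (2 * norm z)" using \<eta> by (intro mult_left_mono) auto
      also have "\<dots> = 4 * norm y * N" by (simp add: N_def power2_eq_square)
      finally have 1: "norm ((1 / of_real N) *s (cinner y z *s \<eta> - cinner y \<eta> *s z)) \<le> 4 * norm y"
        using N unfolding norm_smult[of "1 / of_real N"] by (simp add: norm_divide divide_le_eq)
      have 2: "norm (a *\<^sub>R y) \<le> norm y" "norm (b *\<^sub>R (\<i> *s y)) \<le> norm y"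
        using ab by (simp_all add: norm_smult mult_left_le_one_le)
      have "norm (B *v y) \<le> norm (a *\<^sub>R y) + (norm (b *\<^sub>R (\<i> *s y)) + norm ((1 / of_real N) *s (cinner y z *s \<eta> - cinner y \<eta> *s z)))"
        unfolding HB iHy by (intro norm_triangle_le add_left_mono norm_triangle_ineq)
      then show "norm (B *v y) \<le> 6 * norm y" using 1 2 by simp
    qed
    show "\<forall>t. unitary (V t)"
      unfolding unitary_def V_def adjoint_spectral_matrix spectral_matrix_mult[OF U]
      using spectral_matrix_1[OF U] by (simp add: exp_cnj exp_add[symmetric])
    show "V 0 = mat 1" using spectral_matrix_1[OF U] by (simp add: V_def)
    show "\<forall>t y. ((\<lambda>t. exp (a * t) *\<^sub>R (V t *v y)) has_vector_derivative B *v (exp (a * t) *\<^sub>R (V t *v y))) (at t)"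
      unfolding flow B_def using spectral_exp_has_vector_derivative[OF U] by blast
    show "continuous_on UNIV (\<lambda>p. V (fst p) *v snd p)"
      unfolding V_def by (rule spectral_exp_continuous)
  qed
qed

section \<open>The maximum principle\<close>

lemma second_derivative_test_max:
  fixes f :: "real \<Rightarrow> real"
  assumes d: "d > 0"
    and f: "\<And>t. \<bar>t\<bar> < d \<Longrightarrow> (f has_real_derivative f1 t) (at t)"
    and f1: "(f1 has_real_derivative f2) (at 0)"
    and max: "\<And>t. \<bar>t\<bar> < d \<Longrightarrow> f t \<le> f 0"
  shows "f2 \<le> 0"
proof (rule ccontr)
  assume "\<not> f2 \<le> 0"
  then have pos: "f2 > 0" by simp
  have "f1 0 = 0"
    using f[of 0] d max by (intro DERIV_local_max[of f _ 0 d]) auto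
  obtain e where e: "e > 0" "\<And>h. 0 < h \<Longrightarrow> h < e \<Longrightarrow> f1 0 < f1 (0 + h)"
    using DERIV_pos_inc_right[OF f1 pos] by blast
  define h where "h = min d e / 2"
  have h: "0 < h" "h < d" "h < e" using d e by (auto simp: h_def)
  have "\<exists>z>0. z < h \<and> f h - f 0 = (h - 0) * f1 z"
    using h by (intro MVT2 f) auto
  then obtain z where z: "0 < z" "z < h" "f h - f 0 = h * f1 z" by auto
  have "f1 z > 0" using e(2)[of z] z h \<open>f1 0 = 0\<close> by simp
  then have "f h > f 0" using z h by (simp add: algebra_simps)
  then show False using max[of h] h by simp
qed

lemma linear_matrix_vector: "linear ((*v) (B :: complex ^ 'n::finite ^ 'm))"
  by (rule linearI) (simp_all add: matrix_vector_right_distrib matrix_vector_mult_scaleR_complex)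

lemma bounded_linear_matrix_vector: "bounded_linear ((*v) (B :: complex ^ 'n::finite ^ 'm::finite))"
  using linear_matrix_vector by (simp add: linear_conv_bounded_linear)

text \<open>The second derivative at \<open>t = 0\<close> of \<open>exp (- 2 a t) u (exp (t B) y)\<close>.\<close>
definition flow_second_deriv ::
    "(complex ^ 'n::finite \<Rightarrow> real) \<Rightarrow> real \<Rightarrow> complex ^ 'n ^ 'n \<Rightarrow> complex ^ 'n \<Rightarrow> real" where
  "flow_second_deriv u a B y = 4 * a\<^sup>2 * u y - 4 * a * inner (gradient u y) (B *v y)
     + inner (hessian_op u y (B *v y)) (B *v y) + inner (gradient u y) (B *v (B *v y))"

text \<open>As \<open>c\<close> is an integral curve of the linear field \<open>B\<close>, the second derivative at any time is the one at
time 0, transported along the curve and rescaled.\<close>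
lemma flow_derivatives:
  fixes u :: "complex ^ 'n::finite \<Rightarrow> real"
  assumes S: "open S" and u: "C_on 2 u S" and c: "c t \<in> S"
    and dc: "(c has_vector_derivative B *v c t) (at t)"
  shows "((\<lambda>t. exp (- 2 * a * t) * u (c t)) has_real_derivative
      exp (- 2 * a * t) * (inner (gradient u (c t)) (B *v c t) - 2 * a * u (c t))) (at t)"
    and "((\<lambda>t. exp (- 2 * a * t) * (inner (gradient u (c t)) (B *v c t) - 2 * a * u (c t)))
      has_real_derivative exp (- 2 * a * t) * flow_second_deriv u a B (c t)) (at t)"
proof -
  have 1: "((\<lambda>t. u (c t)) has_real_derivative inner (gradient u (c t)) (B *v c t)) (at t)"
    by (rule has_real_derivative_along_curve[OF has_derivative_gradient[OF S u c] dc])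
  have E: "((\<lambda>t. exp (- 2 * a * t)) has_real_derivative exp (- 2 * a * t) * (- 2 * a)) (at t)"
    by (auto intro!: derivative_eq_intros)
  show "((\<lambda>t. exp (- 2 * a * t) * u (c t)) has_real_derivative
      exp (- 2 * a * t) * (inner (gradient u (c t)) (B *v c t) - 2 * a * u (c t))) (at t)"
    by (rule DERIV_cong[OF DERIV_mult[OF E 1]]) (simp add: algebra_simps)
  have G: "((\<lambda>t. gradient u (c t)) has_vector_derivative hessian_op u (c t) (B *v c t)) (at t)"
  proof -
    have "((\<lambda>t. gradient u (c t)) has_derivative (\<lambda>h. hessian_op u (c t) (h *\<^sub>R (B *v c t)))) (at t)"
      using has_derivative_compose[OF dc[unfolded has_vector_derivative_def] gradient_has_derivative[OF S u c]] by simp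
    then show ?thesis by (simp add: has_vector_derivative_def hessian_op_scaleR)
  qed
  have B: "((\<lambda>t. B *v c t) has_vector_derivative B *v (B *v c t)) (at t)"
    by (rule bounded_linear.has_vector_derivative[OF bounded_linear_matrix_vector dc])
  have 2: "((\<lambda>t. inner (gradient u (c t)) (B *v c t)) has_real_derivative
      inner (gradient u (c t)) (B *v (B *v c t)) + inner (hessian_op u (c t) (B *v c t)) (B *v c t)) (at t)"
    using bounded_bilinear.has_vector_derivative[OF bounded_bilinear_inner G B]
    by (simp add: has_real_derivative_iff_has_vector_derivative)
  show "((\<lambda>t. exp (- 2 * a * t) * (inner (gradient u (c t)) (B *v c t) - 2 * a * u (c t)))
      has_real_derivative exp (- 2 * a * t) * flow_second_deriv u a B (c t)) (at t)"
    by (rule DERIV_cong[OF DERIV_mult[OF E DERIV_diff[OF 2 DERIV_cmult[OF 1]]]])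
      (simp add: flow_second_deriv_def algebra_simps power2_eq_square)
qed

lemma symmetric_difference_mean:
  fixes f :: "real \<Rightarrow> real"
  assumes f: "\<And>s. \<bar>s\<bar> \<le> t \<Longrightarrow> (f has_real_derivative f1 s) (at s)"
    and f1: "\<And>s. \<bar>s\<bar> \<le> t \<Longrightarrow> (f1 has_real_derivative f2 s) (at s)" and t: "t > 0"
    and near: "\<And>s. \<bar>s\<bar> \<le> t \<Longrightarrow> \<bar>f2 s - w\<bar> < e"
  shows "\<bar>(f t + f (- t) - 2 * f 0) / t\<^sup>2 - w\<bar> < e"
proof -
  define D where "D m = (case m of 0 \<Rightarrow> f | Suc 0 \<Rightarrow> f1 | _ \<Rightarrow> f2)" for m :: nat
  have D: "\<forall>m s. m < 2 \<and> \<bar>s\<bar> \<le> \<bar>x\<bar> \<longrightarrow> DERIV (D m) s :> D (Suc m) s" if "\<bar>x\<bar> = t" for x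
    using f f1 that by (auto simp: D_def less_Suc_eq numeral_2_eq_2)
  have taylor: "\<exists>s. \<bar>s\<bar> \<le> t \<and> f x = f 0 + f1 0 * x + f2 s / 2 * x\<^sup>2" if "\<bar>x\<bar> = t" for x
    using Maclaurin_bi_le[of D f 2 x, OF _ D[OF that]] that by (auto simp: D_def numeral_2_eq_2)
  obtain s1 where s1: "\<bar>s1\<bar> \<le> t" "f t = f 0 + f1 0 * t + f2 s1 / 2 * t\<^sup>2" using taylor[of t] t by auto
  obtain s2 where s2: "\<bar>s2\<bar> \<le> t" "f (- t) = f 0 - f1 0 * t + f2 s2 / 2 * t\<^sup>2" using taylor[of "- t"] t by auto
  have "f t + f (- t) - 2 * f 0 = (f2 s1 + f2 s2) / 2 * t\<^sup>2" using s1 s2 by (simp add: algebra_simps)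
  then have mean: "(f t + f (- t) - 2 * f 0) / t\<^sup>2 = (f2 s1 + f2 s2) / 2" using t by simp
  show ?thesis unfolding mean using near[OF s1(1)] near[OF s2(1)] by (auto simp: abs_less_iff field_simps)
qed

lemma unitary_transpose: "unitary V \<Longrightarrow> unitary (transpose (V :: complex ^ 'n::finite ^ 'n))"
proof -
  assume "unitary V"
  then have "V ** adjoint_matrix V = mat 1" by (rule unitary_right)
  moreover have "adjoint_matrix (transpose V) ** transpose V = transpose (V ** adjoint_matrix V)"
    by (simp add: matrix_matrix_mult_def transpose_def adjoint_matrix_def vec_eq_iff mult.commute)
  ultimately show ?thesis by (simp add: unitary_def transpose_mat)
qed

text \<open>The pull-back of a solution by a unitary map is a solution, so its complex Hessian competes in Garding's
inequality at \<open>y\<close>. In terms of real second derivatives the linearized operator is a nonnegative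
combination of pure second derivatives in the directions \<open>x i\<close> and \<open>\<i> x i\<close>.\<close>
lemma garding_along_unitary:
  fixes u :: "complex ^ 'n::finite \<Rightarrow> real"
  assumes S: "open S" and u: "C_on 2 u S"
    and adm: "\<And>z. z \<in> S \<Longrightarrow> eigenvalues (complex_hessian u z) \<in> Gamma_cone (Suc k) UNIV"
    and sol: "\<And>z. z \<in> S \<Longrightarrow> sigma (Suc k) (complex_hessian u z) = \<epsilon>"
    and y: "y \<in> S"
  obtains g :: "'n \<Rightarrow> real" and x :: "'n \<Rightarrow> complex ^ 'n"
  where "\<forall>i. 0 \<le> g i"
    and "(\<Sum>i\<in>UNIV. g i * (inner (hessian_op u y (x i)) (x i) + inner (hessian_op u y (\<i> *s x i)) (\<i> *s x i))) > 0"
    and "\<forall>y' V. y' \<in> S \<and> unitary V \<longrightarrow>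
       (\<Sum>i\<in>UNIV. g i * (inner (hessian_op u y (x i)) (x i) + inner (hessian_op u y (\<i> *s x i)) (\<i> *s x i)))
     \<le> (\<Sum>i\<in>UNIV. g i * (inner (hessian_op u y' (V *v x i)) (V *v x i)
          + inner (hessian_op u y' (V *v (\<i> *s x i))) (V *v (\<i> *s x i))))"
proof -
  define Q where "Q y v = inner (hessian_op u y v) v + inner (hessian_op u y (\<i> *s v)) (\<i> *s v)" for y v
  have Q: "Q y v = 4 * hermitian_form (complex_hessian u y) v" if "y \<in> S" for y v
    using hermitian_form_complex_hessian[OF S u that] by (simp add: Q_def)
  let ?A = "complex_hessian u y"
  obtain g :: "'n \<Rightarrow> real" and x :: "'n \<Rightarrow> complex ^ 'n" where g: "\<forall>i. 0 \<le> g i"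
    and eq: "(\<Sum>i\<in>UNIV. g i * hermitian_form ?A (x i)) = real (Suc k) * sigma (Suc k) ?A"
    and le: "\<forall>B. hermitian B \<and> eigenvalues B \<in> Gamma_cone (Suc k) UNIV \<and> sigma (Suc k) B = sigma (Suc k) ?A \<longrightarrow>
      (\<Sum>i\<in>UNIV. g i * hermitian_form ?A (x i)) \<le> (\<Sum>i\<in>UNIV. g i * hermitian_form B (x i))"
    using garding_matrix[OF hermitian_complex_hessian[OF S u y] adm[OF y]] .
  have sumQ: "(\<Sum>i\<in>UNIV. g i * (4 * f i)) = 4 * (\<Sum>i\<in>UNIV. g i * f i)" for f
    by (simp add: sum_distrib_left mult_ac)
  have smult: "V *v (\<i> *s v) = \<i> *s (V *v v)" for V :: "complex ^ 'n ^ 'n" and v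
    by (simp add: matrix_vector_mult_def vec_eq_iff sum_distrib_left mult_ac)
  have "sigma (Suc k) ?A > 0"
    using adm[OF y] by (simp add: sigma_def Gamma_cone_def)
  then have 1: "(\<Sum>i\<in>UNIV. g i * Q y (x i)) > 0"
    unfolding Q[OF y] sumQ eq by simp
  have 2: "(\<Sum>i\<in>UNIV. g i * Q y (x i)) \<le> (\<Sum>i\<in>UNIV. g i * Q y' (V *v x i))" if y': "y' \<in> S" and V: "unitary V" for y' V
  proof -
    let ?Y = "transpose V" and ?H = "complex_hessian u y'"
    let ?B = "?Y ** ?H ** adjoint_matrix ?Y"
    have "hermitian ?B"
      using hermitian_complex_hessian[OF S u y']
      by (simp add: hermitian_def adjoint_matrix_mult adjoint_matrix_adjoint matrix_mul_assoc)
    moreover have ev: "eigenvalues ?B = eigenvalues ?H"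
      by (rule eigenvalues_unitary_conj[OF unitary_transpose[OF V]])
    ultimately have "(\<Sum>i\<in>UNIV. g i * hermitian_form ?A (x i)) \<le> (\<Sum>i\<in>UNIV. g i * hermitian_form ?B (x i))"
      using adm[OF y'] sol[OF y'] sol[OF y] by (intro le[rule_format]) (simp_all add: sigma_def)
    then show ?thesis
      unfolding Q[OF y] Q[OF y'] sumQ hermitian_form_congruence by (simp add: transpose_transpose)
  qed
  show thesis
    using that[of g x] g 1 2 unfolding Q_def smult by blast
qed

text \<open>The function \<open>\<Theta>\<close> is a majorant that is continuous up to the boundary, where it is nonpositive. If the
conclusion failed by \<open>2 m\<close> at \<open>z\<close>, then the points where \<open>\<Theta> \<ge> m\<close> would form a compact subset \<open>N\<close> of
\<open>S\<close>. On \<open>N\<close> the flow stays in \<open>S\<close> for short times, and the function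
\<open>X = (u\<^sub>\<tau> + u\<^sub>-\<^sub>\<tau> - 2 u) / \<tau>\<^sup>2 + C u\<close> is uniformly close to \<open>w + C u\<close>. So \<open>X\<close> has its maximum over \<open>N\<close>
at an interior point of \<open>N\<close>, where all pure second derivatives of \<open>X\<close> are nonpositive. But Garding's
inequality makes a nonnegative combination of them positive.\<close>
lemma maximum_principle:
  fixes u :: "complex ^ 'n::finite \<Rightarrow> real"
  assumes S: "open S" "bounded S" and u: "C_on 2 u S"
    and adm: "\<And>z. z \<in> S \<Longrightarrow> eigenvalues (complex_hessian u z) \<in> Gamma_cone (Suc k) UNIV"
    and sol: "\<And>z. z \<in> S \<Longrightarrow> sigma (Suc k) (complex_hessian u z) = \<epsilon>"
    and V: "\<And>t. unitary (V t)" "V 0 = mat 1"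
    and flow: "\<And>t y. ((\<lambda>t. exp (a * t) *\<^sub>R (V t *v y)) has_vector_derivative B *v (exp (a * t) *\<^sub>R (V t *v y))) (at t)"
    and contV: "continuous_on UNIV (\<lambda>p. V (fst p) *v snd p)"
    and C: "C > 0" and \<Theta>: "continuous_on (closure S) \<Theta>" "\<And>z. z \<in> frontier S \<Longrightarrow> \<Theta> z \<le> 0"
    and bound: "\<And>z. z \<in> S \<Longrightarrow> flow_second_deriv u a B z + C * u z \<le> \<Theta> z"
    and z: "z \<in> S"
  shows "flow_second_deriv u a B z + C * u z \<le> 0"
proof (rule ccontr)
  let ?W = "flow_second_deriv u a B"
  assume "\<not> ?W z + C * u z \<le> 0"
  then have pos: "?W z + C * u z > 0" by simp
  define m where "m = (?W z + C * u z) / 2"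
  have m: "m > 0" using pos by (simp add: m_def)
  define N where "N = closure S \<inter> \<Theta> -` {m..}"
  have clos: "closure S = S \<union> frontier S"
    using S(1) by (auto simp: frontier_def interior_open closure_def)
  have NS: "N \<subseteq> S" using m \<Theta>(2) clos by (fastforce simp: N_def)
  have cN: "compact N"
    unfolding N_def compact_eq_bounded_closed
    using \<Theta>(1) S(2) by (auto intro!: continuous_closed_preimage intro: bounded_subset[OF bounded_closure])
  have zN: "z \<in> N" using bound[OF z] m z closure_subset by (auto simp: N_def m_def)
  define F where "F t y = exp (a * t) *\<^sub>R (V t *v y)" for t y
  have F0: "F 0 y = y" for y by (simp add: F_def V(2))
  have contF: "continuous_on UNIV (\<lambda>p. F (fst p) (snd p))"
    unfolding F_def by (intro continuous_intros contV)
  have contW: "continuous_on T (\<lambda>p. ?W (f p))" if "continuous_on T f" "f ` T \<subseteq> S" for T :: "(real \<times> (complex ^ 'n)) set" and f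
    unfolding flow_second_deriv_def
    by (intro continuous_intros continuous_on_hessian_op[OF S(1) u] that
        continuous_on_compose2[OF C2_continuous(1)[OF S(1) u] that]
        continuous_on_compose2[OF continuous_on_gradient[OF S(1) u] that])
  define G0 where "G0 = (\<lambda>p. F (fst p) (snd p)) -` S \<inter> (UNIV \<times> S)"
  have "open ((\<lambda>p. F (fst p) (snd p)) -` S)"
    using contF S(1) by (simp add: continuous_on_open_vimage)
  then have openG0: "open G0" unfolding G0_def using S(1) by (intro open_Int open_Times) auto
  \<comment> \<open>The error of the second derivative at time \<open>fst p\<close> against the one at time 0; it is small near
    \<open>{0} \<times> N\<close> by compactness.\<close>
  define dev where "dev p = \<bar>exp (- 2 * a * fst p) * ?W (F (fst p) (snd p)) - ?W (snd p)\<bar>" for p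
  have "continuous_on G0 dev"
    unfolding dev_def by (intro continuous_intros contW continuous_on_subset[OF contF]) (auto simp: G0_def)
  then have "open (G0 \<inter> dev -` {..<m / 4})" using openG0 by (intro continuous_open_preimage) auto
  moreover have "{0} \<times> N \<subseteq> G0 \<inter> dev -` {..<m / 4}"
    using NS m by (auto simp: G0_def dev_def F0)
  moreover have "compact ({0} \<times> N)" using cN by (intro compact_Times) auto
  ultimately obtain e where e: "e > 0" "(\<Union>p\<in>{0} \<times> N. ball p e) \<subseteq> G0 \<inter> dev -` {..<m / 4}"
    using compact_subset_open_imp_ball_epsilon_subset by metis
  define \<tau> where "\<tau> = e / 2"
  have \<tau>: "\<tau> > 0" using e by (simp add: \<tau>_def)
  have near: "F s y \<in> S" "dev (s, y) < m / 4" if "\<bar>s\<bar> \<le> \<tau>" "y \<in> N" for s y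
  proof -
    have "dist (0, y) (s, y) < e" using that e by (simp add: dist_Pair_Pair \<tau>_def)
    then have "(s, y) \<in> (\<Union>p\<in>{0} \<times> N. ball p e)" using that by auto
    then have "(s, y) \<in> G0 \<inter> dev -` {..<m / 4}" using e(2) by blast
    then show "F s y \<in> S" "dev (s, y) < m / 4" by (auto simp: G0_def)
  qed
  define X where "X y = (exp (- 2 * a * \<tau>) * u (F \<tau> y) + exp (2 * a * \<tau>) * u (F (- \<tau>) y) - 2 * u y) / \<tau>\<^sup>2 + C * u y" for y
  have XW: "\<bar>X y - (?W y + C * u y)\<bar> < m / 4" if y: "y \<in> N" for y
  proof -
    have dF: "((\<lambda>t. F t y) has_vector_derivative B *v F t y) (at t)" for t
      unfolding F_def by (rule flow)
    have "\<bar>(exp (- 2 * a * \<tau>) * u (F \<tau> y) + exp (- 2 * a * (- \<tau>)) * u (F (- \<tau>) y) - 2 * (exp (- 2 * a * 0) * u (F 0 y))) / \<tau>\<^sup>2 - ?W y\<bar> < m / 4"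
      by (rule symmetric_difference_mean[OF flow_derivatives(1)[OF S(1) u near(1)[OF _ y] dF]
            flow_derivatives(2)[OF S(1) u near(1)[OF _ y] dF] \<tau>])
        (use near(2)[OF _ y] in \<open>simp_all add: dev_def\<close>)
    then show ?thesis by (simp add: X_def F0)
  qed
  have contFs: "continuous_on T (F s)" for s and T :: "(complex ^ 'n) set"
  proof -
    have "continuous_on T (\<lambda>y. F (fst (s, y)) (snd (s, y)))"
      by (rule continuous_on_compose2[OF contF]) (auto intro!: continuous_intros)
    then show ?thesis by simp
  qed
  have contX: "continuous_on N X"
    unfolding X_def using near(1) NS \<tau>
    by (intro continuous_intros continuous_on_compose2[OF C2_continuous(1)[OF S(1) u] contFs]
        continuous_on_subset[OF C2_continuous(1)[OF S(1) u] NS]) auto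
  from continuous_attains_sup[OF cN _ contX] zN
  obtain y where y: "y \<in> N" and ymax: "\<And>y'. y' \<in> N \<Longrightarrow> X y' \<le> X y" by blast
  have yS: "y \<in> S" using y NS by blast
  have "?W y + C * u y > m"
  proof -
    have Wz: "?W z + C * u z = 2 * m" by (simp add: m_def)
    have "m < q" if "\<bar>p - q\<bar> < m / 4" "\<bar>p' - 2 * m\<bar> < m / 4" "p' \<le> p" for p q p' :: real
      using that m by (simp add: abs_if split: if_splits)
    from this[OF XW[OF y] XW[OF zN, unfolded Wz] ymax[OF zN]] show ?thesis .
  qed
  then have "\<Theta> y > m" using bound[OF yS] by simp
  moreover have "open (S \<inter> \<Theta> -` {m<..})"
    using S(1) continuous_on_subset[OF \<Theta>(1) closure_subset] by (intro continuous_open_preimage) auto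
  ultimately obtain r where r: "r > 0" "ball y r \<subseteq> S \<inter> \<Theta> -` {m<..}"
    using yS openE[of "S \<inter> \<Theta> -` {m<..}" y] by auto
  have rN: "ball y r \<subseteq> N" using r(2) closure_subset[of S] by (auto simp: N_def subset_iff intro: less_imp_le)
  have linF: "F s (x + t *\<^sub>R v) = F s x + t *\<^sub>R F s v" for s x t v
    by (simp add: F_def matrix_vector_right_distrib matrix_vector_mult_scaleR_complex scaleR_add_right mult_ac)
  have second: "(inner (hessian_op u (F \<tau> y) (V \<tau> *v v)) (V \<tau> *v v)
      + inner (hessian_op u (F (- \<tau>) y) (V (- \<tau>) *v v)) (V (- \<tau>) *v v)
      - 2 * inner (hessian_op u y v) v) / \<tau>\<^sup>2 + C * inner (hessian_op u y v) v \<le> 0" for v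
  proof -
    define d where "d = r / (norm v + 1)"
    have nv: "norm v + 1 > 0" by (simp add: add_nonneg_pos)
    then have d: "d > 0" using r by (simp add: d_def)
    have inN: "y + t *\<^sub>R v \<in> N" if "\<bar>t\<bar> < d" for t
    proof -
      have "norm (t *\<^sub>R v) \<le> \<bar>t\<bar> * (norm v + 1)" by (simp add: mult_left_mono)
      also have "\<dots> < d * (norm v + 1)" using that nv by (intro mult_strict_right_mono) auto
      also have "\<dots> = r" using nv by (simp add: d_def)
      finally show ?thesis using rN by (auto simp: dist_norm)
    qed
    define f where "f t = (exp (- 2 * a * \<tau>) * u (F \<tau> y + t *\<^sub>R F \<tau> v) + exp (2 * a * \<tau>) * u (F (- \<tau>) y + t *\<^sub>R F (- \<tau>) v)
       - 2 * u (y + t *\<^sub>R v)) / \<tau>\<^sup>2 + C * u (y + t *\<^sub>R v)" for t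
    define f1 where "f1 t = (exp (- 2 * a * \<tau>) * inner (gradient u (F \<tau> y + t *\<^sub>R F \<tau> v)) (F \<tau> v)
       + exp (2 * a * \<tau>) * inner (gradient u (F (- \<tau>) y + t *\<^sub>R F (- \<tau>) v)) (F (- \<tau>) v)
       - 2 * inner (gradient u (y + t *\<^sub>R v)) v) / \<tau>\<^sup>2 + C * inner (gradient u (y + t *\<^sub>R v)) v" for t
    define f2 where "f2 = (exp (- 2 * a * \<tau>) * inner (hessian_op u (F \<tau> y + 0 *\<^sub>R F \<tau> v) (F \<tau> v)) (F \<tau> v)
       + exp (2 * a * \<tau>) * inner (hessian_op u (F (- \<tau>) y + 0 *\<^sub>R F (- \<tau>) v) (F (- \<tau>) v)) (F (- \<tau>) v)
       - 2 * inner (hessian_op u (y + 0 *\<^sub>R v) v) v) / \<tau>\<^sup>2 + C * inner (hessian_op u (y + 0 *\<^sub>R v) v) v"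
    have in1: "F \<tau> y + t *\<^sub>R F \<tau> v \<in> S" "F (- \<tau>) y + t *\<^sub>R F (- \<tau>) v \<in> S" "y + t *\<^sub>R v \<in> S" if "\<bar>t\<bar> < d" for t
      using near(1)[OF _ inN[OF that], of \<tau>] near(1)[OF _ inN[OF that], of "- \<tau>"] inN[OF that] NS \<tau> by (auto simp: linF)
    have in0: "F \<tau> y + 0 *\<^sub>R F \<tau> v \<in> S" "F (- \<tau>) y + 0 *\<^sub>R F (- \<tau>) v \<in> S" "y + 0 *\<^sub>R v \<in> S"
      using in1[of 0] d by simp_all
    have "f2 \<le> 0"
    proof (rule second_derivative_test_max[OF d])
      show "(f has_real_derivative f1 t) (at t)" if "\<bar>t\<bar> < d" for t
        unfolding f_def f1_def
        by (intro DERIV_add DERIV_diff DERIV_cmult DERIV_cdivide DERIV_line(1)[OF S(1) u] in1 that)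
      show "(f1 has_real_derivative f2) (at 0)"
        unfolding f1_def f2_def
        by (intro DERIV_add DERIV_diff DERIV_cmult DERIV_cdivide DERIV_line(2)[OF S(1) u] in0)
      show "f t \<le> f 0" if "\<bar>t\<bar> < d" for t
        using ymax[OF inN[OF that]] by (simp add: f_def X_def linF)
    qed
    \<comment> \<open>The factor \<open>exp (- 2 a t)\<close> compensates the dilation, so only the unitary part is left.\<close>
    moreover have "exp (- 2 * a * \<tau>) * inner (hessian_op u x (F \<tau> v)) (F \<tau> v) = inner (hessian_op u x (V \<tau> *v v)) (V \<tau> *v v)" for x
      by (simp add: F_def hessian_op_scaleR mult.assoc[symmetric] exp_add[symmetric])
    moreover have "exp (2 * a * \<tau>) * inner (hessian_op u x (F (- \<tau>) v)) (F (- \<tau>) v) = inner (hessian_op u x (V (- \<tau>) *v v)) (V (- \<tau>) *v v)" for x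
      by (simp add: F_def hessian_op_scaleR mult.assoc[symmetric] exp_add[symmetric])
    ultimately show ?thesis by (simp add: f2_def)
  qed
  obtain g :: "'n \<Rightarrow> real" and x :: "'n \<Rightarrow> complex ^ 'n"
  where g: "\<forall>i. 0 \<le> g i"
    and gpos: "(\<Sum>i\<in>UNIV. g i * (inner (hessian_op u y (x i)) (x i) + inner (hessian_op u y (\<i> *s x i)) (\<i> *s x i))) > 0"
    and gle: "\<forall>y' V. y' \<in> S \<and> unitary V \<longrightarrow>
       (\<Sum>i\<in>UNIV. g i * (inner (hessian_op u y (x i)) (x i) + inner (hessian_op u y (\<i> *s x i)) (\<i> *s x i)))
     \<le> (\<Sum>i\<in>UNIV. g i * (inner (hessian_op u y' (V *v x i)) (V *v x i)
          + inner (hessian_op u y' (V *v (\<i> *s x i))) (V *v (\<i> *s x i))))"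
    using garding_along_unitary[OF S(1) u adm sol yS] .
  define q where "q i = inner (hessian_op u y (x i)) (x i) + inner (hessian_op u y (\<i> *s x i)) (\<i> *s x i)" for i
  define qt where "qt t i = inner (hessian_op u (F t y) (V t *v x i)) (V t *v x i)
          + inner (hessian_op u (F t y) (V t *v (\<i> *s x i))) (V t *v (\<i> *s x i))" for t i
  have sum_le: "(\<Sum>i\<in>UNIV. g i * q i) \<le> (\<Sum>i\<in>UNIV. g i * qt t i)" if "\<bar>t\<bar> \<le> \<tau>" for t
    unfolding q_def qt_def by (intro gle[rule_format] conjI near(1)[OF that y] V(1))
  have "(qt \<tau> i + qt (- \<tau>) i - 2 * q i) / \<tau>\<^sup>2 + C * q i \<le> 0" for i
    using add_mono[OF second[of "x i"] second[of "\<i> *s x i"]]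
    by (simp add: q_def qt_def add_divide_distrib diff_divide_distrib algebra_simps)
  then have "(\<Sum>i\<in>UNIV. g i * ((qt \<tau> i + qt (- \<tau>) i - 2 * q i) / \<tau>\<^sup>2 + C * q i)) \<le> 0"
    using g by (intro sum_nonpos mult_nonneg_nonpos) auto
  also have "(\<Sum>i\<in>UNIV. g i * ((qt \<tau> i + qt (- \<tau>) i - 2 * q i) / \<tau>\<^sup>2 + C * q i))
     = ((\<Sum>i\<in>UNIV. g i * qt \<tau> i) + (\<Sum>i\<in>UNIV. g i * qt (- \<tau>) i) - 2 * (\<Sum>i\<in>UNIV. g i * q i)) / \<tau>\<^sup>2 + C * (\<Sum>i\<in>UNIV. g i * q i)"
    by (simp add: sum_distrib_left sum.distrib sum_subtractf sum_divide_distrib algebra_simps add_divide_distrib diff_divide_distrib)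
  finally have "((\<Sum>i\<in>UNIV. g i * qt \<tau> i) + (\<Sum>i\<in>UNIV. g i * qt (- \<tau>) i) - 2 * (\<Sum>i\<in>UNIV. g i * q i)) / \<tau>\<^sup>2 + C * (\<Sum>i\<in>UNIV. g i * q i) \<le> 0" .
  moreover have "((\<Sum>i\<in>UNIV. g i * qt \<tau> i) + (\<Sum>i\<in>UNIV. g i * qt (- \<tau>) i) - 2 * (\<Sum>i\<in>UNIV. g i * q i)) / \<tau>\<^sup>2 \<ge> 0"
    using sum_le[of \<tau>] sum_le[of "- \<tau>"] \<tau> by (intro divide_nonneg_nonneg) auto
  moreover have "C * (\<Sum>i\<in>UNIV. g i * q i) > 0" using C gpos by (simp add: q_def)
  ultimately show False by linarith
qed

section \<open>The second derivative estimate\<close>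

lemma hessian_entry_eq_extension:
  assumes S: "open S" and g: "continuous_on (closure S) g" "\<And>x. x \<in> S \<Longrightarrow> g x = iter_deriv [b, c] f x"
    and x: "x \<in> closure S"
  shows "hessian_entry S f b c x = g x"
  unfolding hessian_entry_def
proof (rule tendsto_Lim)
  have "x islimpt S"
  proof (cases "x \<in> S")
    case True
    then show ?thesis using S by (simp add: interior_limit_point interior_open)
  qed (use x in \<open>simp add: closure_def\<close>)
  then show "\<not> trivial_limit (at x within S)" by (simp add: trivial_limit_within)
  have "(g \<longlongrightarrow> g x) (at x within S)"
    using g(1) x closure_subset by (auto simp: continuous_on intro: tendsto_within_subset)
  then show "(iter_deriv [b, c] f \<longlongrightarrow> g x) (at x within S)"
    by (rule Lim_transform_eventually) (simp add: eventually_at_filter g(2))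
qed

text \<open>An upper bound for the quadratic form and a nonnegative trace bound the diagonal entries below; the other
entries follow by polarization with \<open>b + c\<close> and \<open>b - c\<close>, which have norm at most 2.\<close>
lemma hessian_bound_from_upper_bound:
  fixes f :: "'a::euclidean_space \<Rightarrow> real"
  assumes upper: "\<And>v. norm v \<le> 1 \<Longrightarrow> inner (hessian_op f x v) v \<le> K"
    and trace: "0 \<le> (\<Sum>b\<in>Basis. inner (hessian_op f x b) b)"
    and sym: "\<And>v w. inner (hessian_op f x v) w = inner (hessian_op f x w) v"
  shows "sqrt (\<Sum>b\<in>Basis. \<Sum>c\<in>Basis. (iter_deriv [b, c] f x)\<^sup>2) \<le> real DIM('a) * (real DIM('a) + 2) * K"
proof -
  define h where "h v w = inner (hessian_op f x v) w" for v w
  let ?D = "real DIM('a)"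
  have K: "K \<ge> 0" using upper[of 0] by (simp add: linear_0[OF linear_hessian_op])
  have lower: "- (?D * K) \<le> h b b" if b: "b \<in> Basis" for b
  proof -
    have "(\<Sum>c\<in>Basis. h c c) = h b b + (\<Sum>c\<in>Basis - {b}. h c c)"
      using b by (simp add: sum.remove)
    also have "(\<Sum>c\<in>Basis - {b}. h c c) \<le> (\<Sum>c\<in>Basis - {b}. K)"
      unfolding h_def by (intro sum_mono upper) auto
    also have "\<dots> \<le> (\<Sum>c\<in>(Basis::'a set). K)" using K by (intro sum_mono2) auto
    finally show ?thesis using trace by (simp add: h_def)
  qed
  have four: "h v v \<le> 4 * K" if "norm v \<le> 2" for v
  proof -
    have "norm ((1 / 2) *\<^sub>R v) \<le> 1" using that by simp
    from upper[OF this] show ?thesis by (simp add: h_def hessian_op_scaleR)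
  qed
  have entry: "\<bar>h b c\<bar> \<le> (?D + 2) * K" if bc: "b \<in> Basis" "c \<in> Basis" for b c
  proof -
    have n: "norm (b + c) \<le> 2" "norm (b - c) \<le> 2"
      using norm_triangle_ineq[of b c] norm_triangle_ineq4[of b c] bc by simp_all
    have "h (b + c) (b + c) = h b b + 2 * h b c + h c c" "h (b - c) (b - c) = h b b - 2 * h b c + h c c"
      using sym[of b c] linear_diff[OF linear_hessian_op, of f x b c]
      by (simp_all add: h_def hessian_op_add inner_add_left inner_add_right inner_diff_left inner_diff_right)
    then have "2 * h b c \<le> 4 * K + ?D * K + ?D * K" "- (2 * h b c) \<le> 4 * K + ?D * K + ?D * K"
      using four[OF n(1)] four[OF n(2)] lower[OF bc(1)] lower[OF bc(2)] by linarith+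
    then show ?thesis by (simp add: abs_le_iff algebra_simps)
  qed
  have "(\<Sum>b\<in>Basis. \<Sum>c\<in>Basis. (iter_deriv [b, c] f x)\<^sup>2) \<le> (\<Sum>b\<in>(Basis::'a set). \<Sum>c\<in>(Basis::'a set). ((?D + 2) * K)\<^sup>2)"
  proof (intro sum_mono)
    fix b c :: 'a assume bc: "b \<in> Basis" "c \<in> Basis"
    have "\<bar>h b c\<bar>\<^sup>2 \<le> ((?D + 2) * K)\<^sup>2" by (intro power_mono entry bc) auto
    then show "(iter_deriv [b, c] f x)\<^sup>2 \<le> ((?D + 2) * K)\<^sup>2"
      unfolding iter_deriv_eq_hessian_op[OF bc] h_def by simp
  qed
  also have "\<dots> = (?D * (?D + 2) * K)\<^sup>2" by (simp add: power2_eq_square algebra_simps)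
  finally have "sqrt (\<Sum>b\<in>Basis. \<Sum>c\<in>Basis. (iter_deriv [b, c] f x)\<^sup>2) \<le> sqrt ((?D * (?D + 2) * K)\<^sup>2)"
    by (rule real_sqrt_le_mono)
  then show ?thesis using K by simp
qed

lemma inner_le_norms: "norm v \<le> p \<Longrightarrow> norm w \<le> q \<Longrightarrow> \<bar>inner v w\<bar> \<le> p * q"
  using Cauchy_Schwarz_ineq2[of v w] mult_mono[of "norm v" p "norm w" q] norm_ge_zero[of v]
  by (meson norm_ge_zero order_trans)

text \<open>The maximum principle for the flow with \<open>B z = \<xi>\<close>. With \<open>|a| \<le> 1\<close> and \<open>|B y| \<le> 6 |y|\<close> the gradient terms of the
second derivative along the flow contribute at most \<open>24 + 36\<close> times \<open>C0 (- u)\<close>, and the boundary value of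
the Hessian term another \<open>36\<close> times that, whence the multiple 96. Solving for the Hessian term at
\<open>z\<close> costs a further \<open>36 + 4\<close> for the gradient and \<open>4\<close> for \<open>u\<close>.\<close>
lemma scaled_second_derivative_bound:
  fixes u :: "complex ^ 'n::finite \<Rightarrow> real"
  assumes S: "open S" "bounded S" "0 \<notin> S" and u: "C_on 2 u S"
    and adm: "\<And>z. z \<in> S \<Longrightarrow> eigenvalues (complex_hessian u z) \<in> Gamma_cone (Suc k) UNIV"
    and sol: "\<And>z. z \<in> S \<Longrightarrow> sigma (Suc k) (complex_hessian u z) = \<epsilon>"
    and neg: "\<And>z. z \<in> S \<Longrightarrow> u z < 0"
    and C0: "C0 > 0"
    and grad: "\<And>z. z \<in> S \<Longrightarrow> norm z * norm (gradient u z) \<le> C0 * (- u z)"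
    and contu: "continuous_on (closure S) u"
    and h: "continuous_on (closure S) h"
    and hess: "\<And>z v. z \<in> S \<Longrightarrow> norm (hessian_op u z v) \<le> h z * norm v"
    and bdry: "\<And>z. z \<in> frontier S \<Longrightarrow> (norm z)\<^sup>2 * h z \<le> C0 * (- u z)"
    and z: "z \<in> S" and \<xi>: "norm \<xi> \<le> norm z"
  shows "inner (hessian_op u z \<xi>) \<xi> \<le> (136 * C0 + 4) * (- u z)"
proof -
  have "z \<noteq> 0" using S(3) z by auto
  obtain a :: real and B :: "complex ^ 'n ^ 'n" and V :: "real \<Rightarrow> complex ^ 'n ^ 'n"
  where a: "\<bar>a\<bar> \<le> 1" and Bz: "B *v z = \<xi>" and "\<forall>y. norm (B *v y) \<le> 6 * norm y"
    and "\<forall>t. unitary (V t)" and V0: "V 0 = mat 1"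
    and "\<forall>t y. ((\<lambda>t. exp (a * t) *\<^sub>R (V t *v y)) has_vector_derivative B *v (exp (a * t) *\<^sub>R (V t *v y))) (at t)"
    and cont: "continuous_on UNIV (\<lambda>p. V (fst p) *v snd p)"
    using conformal_flow[OF \<open>z \<noteq> 0\<close> \<xi>] .
  then have B: "norm (B *v y) \<le> 6 * norm y" and V: "unitary (V t)"
    and flow: "((\<lambda>t. exp (a * t) *\<^sub>R (V t *v y)) has_vector_derivative B *v (exp (a * t) *\<^sub>R (V t *v y))) (at t)" for t y
    by blast+
  have gradB: "\<bar>inner (gradient u y) w\<bar> \<le> c * (C0 * (- u y))" if y: "y \<in> S" and w: "norm w \<le> c * norm y" "c \<ge> 0" for y w c
  proof -
    have "\<bar>inner (gradient u y) w\<bar> \<le> norm (gradient u y) * (c * norm y)"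
      using w(1) by (intro inner_le_norms) auto
    also have "\<dots> = c * (norm y * norm (gradient u y))" by simp
    also have "\<dots> \<le> c * (C0 * (- u y))" using grad[OF y] w(2) by (intro mult_left_mono)
    finally show ?thesis .
  qed
  have BB: "norm (B *v (B *v y)) \<le> 36 * norm y" for y using B[of "B *v y"] B[of y] by simp
  have a4: "\<bar>4 * a * s\<bar> \<le> 4 * \<bar>s\<bar>" for s using a by (simp add: abs_mult mult_right_mono)
  define \<Theta> where "\<Theta> y = 36 * ((norm y)\<^sup>2 * h y - C0 * (- u y))" for y
  have "flow_second_deriv u a B z + 96 * C0 * u z \<le> 0"
  proof (rule maximum_principle[where \<Theta> = \<Theta>, OF S(1,2) u adm sol V V0 flow cont _ _ _ _ z])
    show "96 * C0 > 0" using C0 by simp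
    show "continuous_on (closure S) \<Theta>" unfolding \<Theta>_def by (intro continuous_intros h contu)
    show "\<Theta> y \<le> 0" if "y \<in> frontier S" for y using bdry[OF that] by (simp add: \<Theta>_def)
    show "flow_second_deriv u a B y + 96 * C0 * u y \<le> \<Theta> y" if y: "y \<in> S" for y
    proof -
      have 1: "4 * a\<^sup>2 * u y \<le> 0" using neg[OF y] by (simp add: mult_nonneg_nonpos)
      have 2: "\<bar>inner (gradient u y) (B *v y)\<bar> \<le> 6 * (C0 * (- u y))" by (rule gradB[OF y B]) simp
      have 3: "\<bar>inner (gradient u y) (B *v (B *v y))\<bar> \<le> 36 * (C0 * (- u y))" by (rule gradB[OF y BB]) simp
      have hy: "h y \<ge> 0"
      proof -
        have "0 \<le> h y * norm (axis undefined 1 :: complex ^ 'n)"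
          using hess[OF y, of "axis undefined 1"] norm_ge_zero order_trans by blast
        then show ?thesis by (simp add: norm_axis_1)
      qed
      have "inner (hessian_op u y (B *v y)) (B *v y) \<le> norm (hessian_op u y (B *v y)) * norm (B *v y)"
        by (rule norm_cauchy_schwarz)
      also have "\<dots> \<le> (h y * norm (B *v y)) * norm (B *v y)" by (intro mult_right_mono hess y) auto
      also have "\<dots> = h y * (norm (B *v y))\<^sup>2" by (simp add: power2_eq_square)
      also have "\<dots> \<le> h y * (6 * norm y)\<^sup>2" using hy B[of y] by (intro mult_left_mono power_mono) auto
      finally have 4: "inner (hessian_op u y (B *v y)) (B *v y) \<le> 36 * ((norm y)\<^sup>2 * h y)"
        by (simp add: power_mult_distrib mult_ac)
      have 5: "- (4 * a * inner (gradient u y) (B *v y)) \<le> 24 * (C0 * (- u y))"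
        using a4[of "inner (gradient u y) (B *v y)"] 2 by linarith
      show ?thesis
        unfolding flow_second_deriv_def \<Theta>_def using 1 3 4 5 by (simp add: abs_le_iff algebra_simps)
    qed
  qed
  moreover have "\<bar>inner (gradient u z) (B *v \<xi>)\<bar> \<le> 36 * (C0 * (- u z))"
    using BB[of z] unfolding Bz by (intro gradB z) auto
  moreover have "\<bar>inner (gradient u z) \<xi>\<bar> \<le> 1 * (C0 * (- u z))"
    using \<xi> by (intro gradB z) auto
  then have "4 * a * inner (gradient u z) \<xi> \<le> 4 * (C0 * (- u z))"
    using a4[of "inner (gradient u z) \<xi>"] by linarith
  moreover have "- (4 * a\<^sup>2 * u z) \<le> 4 * (- u z)"
  proof -
    have "a\<^sup>2 \<le> 1" using a by (simp add: abs_square_le_1)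
    then have "a\<^sup>2 * (- u z) \<le> 1 * (- u z)" using neg[OF z] by (intro mult_right_mono) auto
    then show ?thesis by simp
  qed
  ultimately show ?thesis unfolding flow_second_deriv_def Bz by (simp add: abs_le_iff algebra_simps)
qed

theorem theorem1p2:
  fixes \<Omega> :: "(complex ^ 'n::finite) set" and k :: nat and C0 :: real
  assumes "1 \<le> k" and "k < CARD('n)"
    and "smooth_bounded_domain \<Omega>" and "0 \<in> \<Omega>" and "pseudoconvex (k - 1) \<Omega>"
    and "C0 > 0"
  shows "\<exists>C>0. \<forall>(usub :: complex ^ 'n \<Rightarrow> real) (\<epsilon> :: real) (r :: real) (u :: complex ^ 'n \<Rightarrow> real).
           \<epsilon> > 0 \<and> r > 0 \<and> cball 0 r \<subseteq> \<Omega> \<and>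
           dirichlet_solution k \<Omega> usub \<epsilon> r u \<and>
           a_priori_estimates k \<Omega> C0 r u \<longrightarrow>
           (\<forall>z\<in>closure (punctured_domain \<Omega> r).
              hessian_norm (punctured_domain \<Omega> r) u z \<le> C * norm z powr (- 2 * real CARD('n) / real k))"
proof -
  define D where "D = real DIM(complex ^ 'n)"
  define K where "K = 136 * C0 + 4"
  define C where "C = D * (D + 2) * K * C0"
  have D: "D > 0" by (simp add: D_def)
  have K: "K > 0" using assms(6) by (simp add: K_def)
  have C: "C > 0" using D K assms(6) by (simp add: C_def)
  obtain l where l: "k = Suc l" using assms(1) by (cases k) auto
  have "hessian_norm (punctured_domain \<Omega> r) u z \<le> C * norm z powr (- 2 * real CARD('n) / real k)"
    if r: "r > 0" and sol: "dirichlet_solution k \<Omega> usub \<epsilon> r u" and est: "a_priori_estimates k \<Omega> C0 r u"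
      and z: "z \<in> closure (punctured_domain \<Omega> r)" for usub u :: "complex ^ 'n \<Rightarrow> real" and \<epsilon> r z
  proof -
    define S where "S = punctured_domain \<Omega> r"
    have S: "open S" "bounded S"
      using assms(3) by (auto simp: S_def smooth_bounded_domain_def intro: open_Diff bounded_diff)
    have far: "norm x \<ge> r" if "x \<in> closure S" for x
    proof -
      have "closure S \<subseteq> - ball 0 r"
        by (intro closure_minimal) (auto simp: S_def)
      then show ?thesis using that by auto
    qed
    have Sc: "S \<subseteq> closure S" by (rule closure_subset)
    have u2: "C_on_closure 2 u S" and adm: "\<And>x. x \<in> S \<Longrightarrow> eigenvalues (complex_hessian u x) \<in> Gamma_cone (Suc l) UNIV"
      and neg: "\<And>x. x \<in> S \<Longrightarrow> u x < 0" and eq: "\<And>x. x \<in> S \<Longrightarrow> sigma (Suc l) (complex_hessian u x) = \<epsilon>"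
      using sol by (auto simp: dirichlet_solution_def k_admissible_def S_def l)
    have u: "C_on 2 u S" and contu: "continuous_on (closure S) u"
      using u2 by (auto simp: C_on_closure_def)
    have "\<exists>g. continuous_on (closure S) g \<and> (\<forall>x\<in>S. g x = iter_deriv [b, c] u x)"
      if "b \<in> Basis" "c \<in> Basis" for b c
    proof -
      have "set [b, c] \<subseteq> Basis \<and> length [b, c] \<le> 2" using that by simp
      then show ?thesis using u2 unfolding C_on_closure_def by blast
    qed
    then obtain G where G: "\<And>b c. b \<in> Basis \<Longrightarrow> c \<in> Basis \<Longrightarrow> continuous_on (closure S) (G b c)"
      "\<And>b c x. b \<in> Basis \<Longrightarrow> c \<in> Basis \<Longrightarrow> x \<in> S \<Longrightarrow> G b c x = iter_deriv [b, c] u x"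
      by metis
    define h where "h x = sqrt (\<Sum>b\<in>Basis. \<Sum>c\<in>Basis. (G b c x)\<^sup>2)" for x
    have conth: "continuous_on (closure S) h" unfolding h_def by (intro continuous_intros G(1))
    have hn: "hessian_norm S u x = h x" if "x \<in> closure S" for x
      unfolding hessian_norm_def h_def
      using hessian_entry_eq_extension[OF S(1) G(1) G(2) that] by simp
    have hS: "h x = sqrt (\<Sum>b\<in>Basis. \<Sum>c\<in>Basis. (iter_deriv [b, c] u x)\<^sup>2)" if "x \<in> S" for x
      unfolding h_def using G(2)[OF _ _ that] by (intro arg_cong[where f = sqrt] sum.cong refl) simp
    have bdry: "(norm x)\<^sup>2 * h x \<le> C0 * (- u x)" if "x \<in> frontier S" for x
    proof -
      have "(norm x)\<^sup>2 * hessian_norm S u x \<le> C0 * (- u x)"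
        using est that unfolding a_priori_estimates_def S_def by blast
      moreover have "x \<in> closure S" using that by (simp add: frontier_def)
      ultimately show ?thesis by (simp only: hn)
    qed
    have grad: "norm x * norm (gradient u x) \<le> C0 * (- u x)"
      and upper: "- u x \<le> C0 * norm x powr hessian_exponent CARD('n) k" if "x \<in> S" for x
      using est that by (auto simp: a_priori_estimates_def S_def)
    have "h x - C * norm x powr (- 2 * real CARD('n) / real k) \<le> 0" if x: "x \<in> S" for x
    proof -
      have nx: "norm x > 0" using far[of x] x Sc r by force
      have hess: "norm (hessian_op u y v) \<le> h y * norm v" if "y \<in> S" for y v
        unfolding hS[OF that] by (rule norm_hessian_op)
      have S0: "0 \<notin> S" using far[of 0] Sc r by auto
      have "h x \<le> real DIM(complex ^ 'n) * (real DIM(complex ^ 'n) + 2) * (K * (- u x) / (norm x)\<^sup>2)"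
        unfolding hS[OF x]
      proof (rule hessian_bound_from_upper_bound)
        show "inner (hessian_op u x v) w = inner (hessian_op u x w) v" for v w
          by (rule hessian_op_symmetric[OF S(1) u x])
        have "esym 1 UNIV (eigenvalues (complex_hessian u x)) > 0"
          using adm[OF x] by (simp add: Gamma_cone_def)
        then have "4 * Re (\<Sum>i\<in>UNIV. complex_hessian u x $ i $ i) > 0"
          by (simp add: sigma_1_eq_trace[OF hermitian_complex_hessian[OF S(1) u x], symmetric] del: Re_sum)
        then show "0 \<le> (\<Sum>b\<in>Basis. inner (hessian_op u x b) b)"
          unfolding trace_complex_hessian[OF S(1) u x] by simp
        fix v :: "complex ^ 'n" assume v: "norm v \<le> 1"
        have "norm (norm x *\<^sub>R v) \<le> norm x" using v by (simp add: mult_left_le)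
        from scaled_second_derivative_bound[OF S S0 u adm eq neg assms(6) grad contu conth hess bdry x this]
        have "(norm x)\<^sup>2 * inner (hessian_op u x v) v \<le> K * (- u x)"
          by (simp add: hessian_op_scaleR power2_eq_square K_def mult.assoc)
        then show "inner (hessian_op u x v) v \<le> K * (- u x) / (norm x)\<^sup>2"
          using nx by (subst pos_le_divide_eq) (simp_all add: mult.commute)
      qed
      also have "\<dots> \<le> D * (D + 2) * (K * (C0 * norm x powr hessian_exponent CARD('n) k) / (norm x)\<^sup>2)"
        unfolding D_def[symmetric] using D K upper[OF x] by (intro mult_left_mono divide_right_mono) auto
      also have "\<dots> = C * (norm x powr hessian_exponent CARD('n) k / (norm x)\<^sup>2)"
        by (simp add: C_def)
      also have "norm x powr hessian_exponent CARD('n) k / (norm x)\<^sup>2 = norm x powr (hessian_exponent CARD('n) k - 2)"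
        using nx by (simp add: powr_diff)
      also have "hessian_exponent CARD('n) k - 2 = - 2 * real CARD('n) / real k"
        by (simp add: hessian_exponent_def)
      finally show ?thesis by simp
    qed
    moreover have "continuous_on (closure S) (\<lambda>x. h x - C * norm x powr (- 2 * real CARD('n) / real k))"
      using far r by (intro continuous_intros conth) force
    moreover have zc: "z \<in> closure S" using z by (simp add: S_def)
    ultimately have "h z - C * norm z powr (- 2 * real CARD('n) / real k) \<le> 0"
      using continuous_le_on_closure by blast
    then show ?thesis using hn[OF zc] by (simp add: S_def)
  qed
  then show ?thesis using C by blast
qed

end
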